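(* Let $G$ be the Heisenberg group of dimension $2n+1$ and let $H$ be a non-trivial connected closed subgroup of $G$. Then there exists a connected closed subgroup $L$ of $G$ such that the action of $L$ on $G^{\mathbb{C}}/H^{\mathbb{C}}$ by left translation is strongly visible.
   Context: Let $n\ge 1$. The Heisenberg Lie algebra $\mathfrak{g}$ is the real Lie algebra with basis $X_1,\dots,X_n,Y_1,\dots,Y_n,Z$ and brackets $[X_i,Y_j]=\delta_{ij}Z$, $[X_i,X_j]=[Y_i,Y_j]=[X_i,Z]=[Y_j,Z]=0$. The Heisenberg group $G=\mathbf{H}_n=\exp\mathfrak{g}$ is the connected and simply connected Lie group with Lie algebra $\mathfrak{g}$. A connected closed subgroup $H$ is $H=\exp\mathfrak{h}$ for a subalgebra $\mathfrak{h}$; non-trivial means $H\neq\{e\}$ and $H\neq G$. Let $\mathfrak{g}^{\mathbb{C}},\mathfrak{h}^{\mathbb{C}}$ be the complexifications, $G^{\mathbb{C}}=\exp\mathfrak{g}^{\mathbb{C}}$ the connected, simply connected complex Lie group with Lie algebra $\mathfrak{g}^{\mathbb{C}}$, and $H^{\mathbb{C}}=\exp\mathfrak{h}^{\mathbb{C}}$. Then $G^{\mathbb{C}}/H^{\mathbb{C}}$ is a connected complex manifold on which $G$ and its subgroups act holomorphically by left translation. Strong visibility: a holomorphic action of a Lie group $L$ on a connected complex manifold $D$ is called strongly visible if there exist a real submanifold $S$ in $D$ and an anti-holomorphic diffeomorphism $\sigma$ of $D$ such that: (V.0) $D':=L\cdot S$ is a non-empty open set in $D$; (S.1) $\sigma|_S=\operatorname{id}_S$;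 (S.2) $\sigma$ preserves each $L$-orbit in $D'$. *)

theory Defs
  imports "HOL-Analysis.Analysis" "HOL-Algebra.Group_Action" "HOL-Algebra.Left_Coset"
begin

section \<open>Holomorphic and smooth maps on open subsets of complex subspaces\<close>

text \<open>
  The model spaces of a complex manifold are complex linear subspaces \<open>W\<close> of a fixed
  \<open>complex^'k\<close>, so that the dimension of a manifold may depend on parameters of a statement.
  The predicates of this section are meant for sets \<open>V\<close> that are relatively open in such a
  \<open>W\<close>. The derivative within \<open>V\<close> is then determined on \<open>W\<close> only; the witnesses below may
  extend it to the ambient space in any (conjugate-)linear way.
\<close>

definition holomorphic_vec_on :: "(complex^'k \<Rightarrow> complex^'l) \<Rightarrow> (complex^'k) set \<Rightarrow> bool" where
  "holomorphic_vec_on f V \<longleftrightarrow>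
     (\<forall>x\<in>V. \<exists>f'. (f has_derivative f') (at x within V) \<and> (\<forall>c v. f' (c *s v) = c *s f' v))"

definition antiholomorphic_vec_on :: "(complex^'k \<Rightarrow> complex^'l) \<Rightarrow> (complex^'k) set \<Rightarrow> bool" where
  "antiholomorphic_vec_on f V \<longleftrightarrow>
     (\<forall>x\<in>V. \<exists>f'. (f has_derivative f') (at x within V) \<and> (\<forall>c v. f' (c *s v) = cnj c *s f' v))"

text \<open>Real differentiability classes \<open>C\<^sup>k\<close> and \<open>C\<^sup>\<infinity>\<close>.\<close>

primrec Ck_on :: "nat \<Rightarrow> ('a::real_normed_vector \<Rightarrow> 'b::real_normed_vector) \<Rightarrow> 'a set \<Rightarrow> bool" where
  "Ck_on 0 f V \<longleftrightarrow> continuous_on V f"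
| "Ck_on (Suc k) f V \<longleftrightarrow>
     (\<exists>f'. (\<forall>x\<in>V. (f has_derivative f' x) (at x within V)) \<and> (\<forall>v. Ck_on k (\<lambda>x. f' x v) V))"

definition smooth_on :: "('a::real_normed_vector \<Rightarrow> 'b::real_normed_vector) \<Rightarrow> 'a set \<Rightarrow> bool" where
  "smooth_on f V \<longleftrightarrow> (\<forall>k. Ck_on k f V)"


section \<open>Complex manifolds\<close>

text \<open>
  A complex manifold is given by a topology \<open>X\<close> and an atlas \<open>A\<close>, a set of charts
  \<open>(U, \<phi>)\<close>. The values of \<open>\<phi>\<close> outside \<open>U\<close> are irrelevant.
\<close>

type_synonym ('a, 'k) chart = "'a set \<times> ('a \<Rightarrow> complex^'k)"

definition complex_chart :: "'a topology \<Rightarrow> ('a, 'k::finite) chart \<Rightarrow> bool" where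
  "complex_chart X = (\<lambda>(U, \<phi>).
     openin X U \<and>
     (\<exists>W. vec.subspace W \<and> openin (top_of_set W) (\<phi> ` U)) \<and>
     homeomorphic_map (subtopology X U) (top_of_set (\<phi> ` U)) \<phi>)"

definition complex_manifold :: "'a topology \<Rightarrow> ('a, 'k::finite) chart set \<Rightarrow> bool" where
  "complex_manifold X A \<longleftrightarrow>
     Hausdorff_space X \<and> second_countable X \<and>
     (\<forall>c\<in>A. complex_chart X c) \<and>
     (\<Union>(U, \<phi>)\<in>A. U) = topspace X \<and>
     (\<forall>(U, \<phi>)\<in>A. \<forall>(V, \<psi>)\<in>A. holomorphic_vec_on (\<psi> \<circ> inv_into U \<phi>) (\<phi> ` (U \<inter> V)))"

definition holomorphic_map ::
  "'a topology \<Rightarrow> ('a, 'k::finite) chart set \<Rightarrow> 'b topology \<Rightarrow> ('b, 'l::finite) chart set \<Rightarrow> ('a \<Rightarrow> 'b) \<Rightarrow> bool"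
  where
  "holomorphic_map X A Y B f \<longleftrightarrow>
     continuous_map X Y f \<and>
     (\<forall>(U, \<phi>)\<in>A. \<forall>(V, \<psi>)\<in>B.
        holomorphic_vec_on (\<psi> \<circ> f \<circ> inv_into U \<phi>) (\<phi> ` {x \<in> U. f x \<in> V}))"

definition antiholomorphic_map ::
  "'a topology \<Rightarrow> ('a, 'k::finite) chart set \<Rightarrow> 'b topology \<Rightarrow> ('b, 'l::finite) chart set \<Rightarrow> ('a \<Rightarrow> 'b) \<Rightarrow> bool"
  where
  "antiholomorphic_map X A Y B f \<longleftrightarrow>
     continuous_map X Y f \<and>
     (\<forall>(U, \<phi>)\<in>A. \<forall>(V, \<psi>)\<in>B.
        antiholomorphic_vec_on (\<psi> \<circ> f \<circ> inv_into U \<phi>) (\<phi> ` {x \<in> U. f x \<in> V}))"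

definition antiholomorphic_diffeo ::
  "'a topology \<Rightarrow> ('a, 'k::finite) chart set \<Rightarrow> ('a \<Rightarrow> 'a) \<Rightarrow> bool" where
  "antiholomorphic_diffeo X A \<sigma> \<longleftrightarrow>
     bij_betw \<sigma> (topspace X) (topspace X) \<and>
     antiholomorphic_map X A X A \<sigma> \<and>
     antiholomorphic_map X A X A (inv_into (topspace X) \<sigma>)"

text \<open>
  \<open>S\<close> is an embedded real \<open>C\<^sup>\<infinity>\<close> submanifold, of some dimension \<open>d\<close>: near each of its
  points, in a holomorphic chart \<open>\<phi>\<close> followed by a diffeomorphism \<open>\<Phi>\<close> between open sets of
  real vector spaces, it is a slice by a \<open>d\<close>-dimensional real subspace \<open>R\<close>.
\<close>

definition real_submanifold :: "'a topology \<Rightarrow> ('a, 'k::finite) chart set \<Rightarrow> 'a set \<Rightarrow> bool" where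
  "real_submanifold X A S \<longleftrightarrow>
     S \<subseteq> topspace X \<and>
     (\<exists>d. \<forall>p\<in>S. \<exists>(U, \<phi>)\<in>A. p \<in> U \<and>
        (\<exists>N (\<Phi> :: complex^'k \<Rightarrow> complex^'k) W R.
           \<phi> p \<in> N \<and> openin (top_of_set (\<phi> ` U)) N \<and>
           subspace W \<and> openin (top_of_set W) (\<Phi> ` N) \<and>
           inj_on \<Phi> N \<and> smooth_on \<Phi> N \<and> smooth_on (inv_into N \<Phi>) (\<Phi> ` N) \<and>
           subspace R \<and> R \<subseteq> W \<and> dim R = d \<and>
           \<Phi> ` (N \<inter> \<phi> ` (S \<inter> U)) = \<Phi> ` N \<inter> R))"


section \<open>Strongly visible actions\<close>

text \<open>
  A Lie group is given as a group \<open>L\<close> with a topology \<open>T\<close> on its carrier, which determines its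
  smooth structure. By a theorem of Bochner and Montgomery a jointly continuous action of a Lie
  group by holomorphic maps is automatically smooth.
\<close>

definition holomorphic_action ::
  "'g monoid \<Rightarrow> 'g topology \<Rightarrow> ('g \<Rightarrow> 'a \<Rightarrow> 'a) \<Rightarrow> 'a topology \<Rightarrow> ('a, 'k::finite) chart set \<Rightarrow> bool" where
  "holomorphic_action L T act X A \<longleftrightarrow>
     topspace T = carrier L \<and>
     group_action L (topspace X) act \<and>
     continuous_map (prod_topology T X) X (\<lambda>(l, x). act l x) \<and>
     (\<forall>l\<in>carrier L. holomorphic_map X A X A (act l))"

definition strongly_visible ::
  "'g monoid \<Rightarrow> 'g topology \<Rightarrow> ('g \<Rightarrow> 'a \<Rightarrow> 'a) \<Rightarrow> 'a topology \<Rightarrow> ('a, 'k::finite) chart set \<Rightarrow> bool" where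
  "strongly_visible L T act X A \<longleftrightarrow>
     complex_manifold X A \<and> connected_space X \<and> holomorphic_action L T act X A \<and>
     (\<exists>S \<sigma>. real_submanifold X A S \<and> antiholomorphic_diffeo X A \<sigma> \<and>
        (let D' = (\<Union>x\<in>S. orbit L act x) in
           D' \<noteq> {} \<and> openin X D' \<and>
           (\<forall>x\<in>S. \<sigma> x = x) \<and>
           (\<forall>x\<in>D'. \<sigma> ` orbit L act x = orbit L act x)))"


section \<open>The Heisenberg group\<close>

text \<open>Elements of the Heisenberg Lie algebra over \<open>'a\<close> in the basis \<open>X\<^sub>i\<close>, \<open>Y\<^sub>i\<close>, \<open>Z\<close>.\<close>

type_synonym ('a, 'n) heis = "('a, 'n + 'n + unit) vec"

definition heis_X :: "'n \<Rightarrow> ('a::field, 'n::finite) heis" where "heis_X i = axis (Inl i) 1"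
definition heis_Y :: "'n \<Rightarrow> ('a::field, 'n::finite) heis" where "heis_Y i = axis (Inr (Inl i)) 1"
definition heis_Z :: "('a::field, 'n::finite) heis" where "heis_Z = axis (Inr (Inr ())) 1"

definition heis_bracket :: "('a::field, 'n::finite) heis \<Rightarrow> ('a, 'n) heis \<Rightarrow> ('a, 'n) heis" where
  "heis_bracket u v =
     (\<Sum>i\<in>UNIV. u $ Inl i * v $ Inr (Inl i) - u $ Inr (Inl i) * v $ Inl i) *s heis_Z"

lemma heis_bracket_basis:
  "heis_bracket (heis_X i) (heis_Y j) = (if i = j then heis_Z else 0)"
  "heis_bracket (heis_X i) (heis_X j) = 0"
  "heis_bracket (heis_Y i) (heis_Y j) = 0"
  "heis_bracket (heis_X i) heis_Z = 0"
  "heis_bracket (heis_Y j) heis_Z = 0"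
  by (simp_all add: heis_bracket_def heis_X_def heis_Y_def heis_Z_def axis_def
        mult_delta_left mult_delta_right sum_subtractf sum_negf)

lemma heis_bracket_antisym: "heis_bracket v u = - heis_bracket u v"
  by (simp add: heis_bracket_def sum_subtractf mult.commute flip: vec.scale_minus_left)

lemma heis_bracket_linear:
  "heis_bracket (u + v) w = heis_bracket u w + heis_bracket v w"
  "heis_bracket w (u + v) = heis_bracket w u + heis_bracket w v"
  "heis_bracket (c *s u) w = c *s heis_bracket u w"
  "heis_bracket w (c *s u) = c *s heis_bracket w u"
  by (simp_all add: heis_bracket_def algebra_simps sum.distrib sum_distrib_left sum_subtractf)

text \<open>
  The connected, simply connected group is realised on the Lie algebra itself by the
  Baker-Campbell-Hausdorff formula (exponential coordinates); the exponential map is then the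
  identity. For \<open>'a = real\<close> this is \<open>G\<close>, for \<open>'a = complex\<close> its complexification.
\<close>

definition heis_group :: "('a::field, 'n::finite) heis monoid" where
  "heis_group = \<lparr>carrier = UNIV, mult = (\<lambda>u v. u + v + (1/2) *s heis_bracket u v), one = 0\<rparr>"

definition heis_exp :: "('a::field, 'n::finite) heis \<Rightarrow> ('a, 'n) heis" where
  "heis_exp v = v"

lemma heis_bracket_self [simp]: "heis_bracket u u = 0"
  by (simp add: heis_bracket_def mult.commute)

lemma heis_bracket_bracket [simp]:
  "heis_bracket u (heis_bracket v w) = 0" "heis_bracket (heis_bracket v w) u = 0"
  by (simp_all add: heis_bracket_def heis_Z_def axis_def)

lemma group_heis_group: "group (heis_group :: ('a::field, 'n::finite) heis monoid)"
proof (rule groupI)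
  fix x :: "('a, 'n) heis"
  have "heis_bracket (- x) x = 0"
    by (simp add: heis_bracket_def sum_negf mult.commute)
  then show "\<exists>y\<in>carrier heis_group. y \<otimes>\<^bsub>heis_group\<^esub> x = \<one>\<^bsub>heis_group\<^esub>"
    by (intro bexI[of _ "- x"]) (simp_all add: heis_group_def)
qed (simp_all add: heis_group_def heis_bracket_linear algebra_simps vec.scale_right_distrib,
     simp_all add: heis_bracket_def)

lemma heis_exp_one_parameter:
  "heis_exp ((s + t) *s v) = heis_exp (s *s v) \<otimes>\<^bsub>heis_group\<^esub> heis_exp (t *s v)"
  by (simp add: heis_exp_def heis_group_def heis_bracket_linear vec.scale_left_distrib)

definition connected_closed_subgroup :: "(real, 'n::finite) heis set \<Rightarrow> bool" where
  "connected_closed_subgroup H \<longleftrightarrow> subgroup H heis_group \<and> closed H \<and> connected H"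

definition lie_algebra_of :: "(real, 'n::finite) heis set \<Rightarrow> (real, 'n) heis set" where
  "lie_algebra_of H = {v. \<forall>t. heis_exp (t *s v) \<in> H}"

definition cvec :: "real^'k \<Rightarrow> complex^'k" where
  "cvec v = (\<chi> j. complex_of_real (v $ j))"

definition complexification :: "(real^'k) set \<Rightarrow> (complex^'k) set" where
  "complexification V = {cvec u + \<i> *s cvec v | u v. u \<in> V \<and> v \<in> V}"

definition complex_subgroup :: "(real, 'n::finite) heis set \<Rightarrow> (complex, 'n) heis set" where
  "complex_subgroup H = heis_exp ` complexification (lie_algebra_of H)"


section \<open>The complex homogeneous space\<close>

text \<open>
  For a closed complex subgroup \<open>K\<close> of the complex Heisenberg group, the space of left cosets of
  \<open>K\<close> with its quotient topology. Its complex structure is the unique one for which the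
  projection is holomorphic and has local holomorphic sections; the atlas is the maximal one.
\<close>

definition coset_topology :: "(complex, 'n::finite) heis set \<Rightarrow> (complex, 'n) heis set topology" where
  "coset_topology K = topology (\<lambda>U. U \<subseteq> lcosets\<^bsub>heis_group\<^esub> K \<and> open {g. g <#\<^bsub>heis_group\<^esub> K \<in> U})"

lemma openin_coset_topology:
  fixes K :: "(complex, 'n::finite) heis set"
  shows "openin (coset_topology K) U \<longleftrightarrow>
     U \<subseteq> lcosets\<^bsub>heis_group\<^esub> K \<and> open {g. g <#\<^bsub>heis_group\<^esub> K \<in> U}"
proof -
  have "istopology (\<lambda>U. U \<subseteq> lcosets\<^bsub>heis_group\<^esub> K \<and> open {g. g <#\<^bsub>heis_group\<^esub> K \<in> U})"
    unfolding istopology_def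
  proof (intro conjI allI impI; (elim conjE)?)
    fix \<U> :: "(complex, 'n) heis set set set"
    assume *: "\<forall>U\<in>\<U>. U \<subseteq> lcosets\<^bsub>heis_group\<^esub> K \<and> open {g. g <#\<^bsub>heis_group\<^esub> K \<in> U}"
    then show "\<Union>\<U> \<subseteq> lcosets\<^bsub>heis_group\<^esub> K" by blast
    have "{g. g <#\<^bsub>heis_group\<^esub> K \<in> \<Union>\<U>} = (\<Union>U\<in>\<U>. {g. g <#\<^bsub>heis_group\<^esub> K \<in> U})" by auto
    with * show "open {g. g <#\<^bsub>heis_group\<^esub> K \<in> \<Union>\<U>}" by auto
  qed (auto simp: Collect_conj_eq)
  then show ?thesis by (simp add: coset_topology_def)
qed

definition coset_atlas ::
  "(complex, 'n::finite) heis set \<Rightarrow> ((complex, 'n) heis set, 'n + 'n + unit) chart set" where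
  "coset_atlas K = {(U, \<phi>).
     complex_chart (coset_topology K) (U, \<phi>) \<and>
     holomorphic_vec_on (\<lambda>g. \<phi> (g <#\<^bsub>heis_group\<^esub> K)) {g. g <#\<^bsub>heis_group\<^esub> K \<in> U} \<and>
     (\<forall>w\<in>\<phi> ` U. \<exists>N (s :: (complex, 'n) heis \<Rightarrow> (complex, 'n) heis).
        w \<in> N \<and> openin (top_of_set (\<phi> ` U)) N \<and> holomorphic_vec_on s N \<and>
        (\<forall>v\<in>N. s v <#\<^bsub>heis_group\<^esub> K \<in> U \<and> \<phi> (s v <#\<^bsub>heis_group\<^esub> K) = v))}"

definition left_translation ::
  "(complex, 'n::finite) heis set \<Rightarrow> (real, 'n) heis \<Rightarrow> (complex, 'n) heis set \<Rightarrow> (complex, 'n) heis set" where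
  "left_translation K l = (\<lambda>C \<in> lcosets\<^bsub>heis_group\<^esub> K. cvec l <#\<^bsub>heis_group\<^esub> C)"

end

theory Submission
  imports Defs
begin

text \<open>
  The action of the whole group \<open>L = G\<close> is strongly visible. Let \<open>h\<close> be the Lie algebra of \<open>H\<close> and \<open>K\<close> its
  complexification, which in exponential coordinates is the complex subgroup itself.

  Modulo the centre the complex group is a vector group, and a real translation there does not
  change imaginary parts. Hence the class of \<open>Im w\<close> modulo \<open>h + \<real> Z\<close> is constant on each double
  coset \<open>G w K\<close>. On an open set this class determines the double coset
  (\<open>orbit_left_translation\<close>). The only obstacle is a translation by an imaginary central element
  \<open>\<i> s Z\<close>. If \<open>Z \<in> h\<close> it lies in \<open>K\<close>. Otherwise conjugating \<open>a u\<close> with \<open>u \<in> h\<close> by \<open>w\<close> adds to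
  \<open>a u\<close> the central term \<open>a [w, u]\<close>, whose imaginary part is \<open>a [Im w, u]\<close>; as soon as
  \<open>[Im w, u] \<noteq> 0\<close>, a suitable real number \<open>a\<close> turns \<open>\<i> s Z\<close> into the product of a real translation
  on the left and an element of \<open>K\<close> on the right (\<open>imaginary_Z_absorbed\<close>). Such \<open>w\<close> exist when
  \<open>h \<noteq> 0\<close> and \<open>Z \<notin> h\<close>, because an element of \<open>h\<close> that commutes with everything is a multiple of \<open>Z\<close>.
  That \<open>h \<noteq> 0\<close> is a small instance of the closed subgroup theorem (\<open>lie_algebra_of_nontrivial\<close>).

  For the involution take a real functional \<open>\<zeta>\<close> with \<open>\<zeta> Z = 1\<close> which vanishes on \<open>h\<close> unless
  \<open>Z \<in> h\<close>. The map \<open>\<theta> x = 2 \<zeta>(x) Z - x\<close> is \<open>-1\<close> modulo the centre and \<open>1\<close> on the centre, hence an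
  involutive automorphism, and it preserves \<open>h\<close>. Composed with complex conjugation it descends to
  an antiholomorphic involution \<open>\<sigma>\<close> of the homogeneous space. It changes \<open>Im w\<close> by a multiple of
  \<open>Z\<close> only, so it preserves the orbits above, and it fixes \<open>\<i> y\<close> whenever \<open>\<zeta> y = 0\<close>. The slice
  \<open>S\<close> consists of the cosets of \<open>\<i> y\<close> for \<open>y\<close> in a complement of \<open>h + \<real> Z\<close> inside the kernel of
  \<open>\<zeta>\<close>, restricted to the open set where the orbits are known.

  The complex structure is handled by one global chart. A projection \<open>P\<close> with kernel \<open>K\<close> that is
  compatible with the centre has the property that each coset \<open>w K\<close> meets the range of \<open>P\<close> in
  the single point \<open>P (w - [P w, w] / 2)\<close>, a polynomial in \<open>w\<close> (locale \<open>coset_slice\<close>). For the other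
  charts of the maximal atlas, their local holomorphic sections show that a self-map of the
  homogeneous space is (anti)holomorphic once it has an (anti)holomorphic lift to the group
  (\<open>twisted_holomorphic_coset_lift\<close>).
\<close>

section \<open>Arithmetic in exponential coordinates\<close>

interpretation heis: group "heis_group :: ('a::field, 'n::finite) heis monoid"
  by (rule group_heis_group)

lemma carrier_heis_group [simp]: "carrier heis_group = UNIV"
  by (simp add: heis_group_def)

lemma one_heis_group [simp]: "\<one>\<^bsub>heis_group\<^esub> = 0"
  by (simp add: heis_group_def)

lemma mult_heis_group: "u \<otimes>\<^bsub>heis_group\<^esub> v = u + v + (1/2) *s heis_bracket u v"
  by (simp add: heis_group_def)

lemma heis_bracket_zero [simp]: "heis_bracket 0 v = 0" "heis_bracket v 0 = 0"
  by (simp_all add: heis_bracket_def)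

lemma heis_bracket_minus [simp]:
  "heis_bracket (- u) v = - heis_bracket u v" "heis_bracket u (- v) = - heis_bracket u v"
  using heis_bracket_linear(3)[of "-1" u v] heis_bracket_linear(4)[of u "-1" v] by simp_all

lemma heis_bracket_diff:
  "heis_bracket (u - v) w = heis_bracket u w - heis_bracket v w"
  "heis_bracket w (u - v) = heis_bracket w u - heis_bracket w v"
  using heis_bracket_linear(1)[of u "-v" w] heis_bracket_linear(2)[of w u "-v"] by simp_all

lemma heis_bracket_Z [simp]: "heis_bracket heis_Z v = 0" "heis_bracket v heis_Z = 0"
  by (simp_all add: heis_bracket_def heis_Z_def axis_def)

lemma heis_bracket_in_Z: obtains c where "heis_bracket u v = c *s heis_Z"
  by (rule that) (rule heis_bracket_def)

lemma heis_Z_nonzero [simp]: "(heis_Z :: ('a::field, 'n::finite) heis) \<noteq> 0"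
  by (simp add: heis_Z_def axis_eq_0_iff)

lemma inv_heis_group [simp]:
  fixes u :: "('a::field, 'n::finite) heis"
  shows "inv\<^bsub>heis_group\<^esub> u = - u"
  by (rule heis.inv_equality) (simp_all add: mult_heis_group)

lemma scaleR_eq_smult: "r *\<^sub>R (v :: complex^'k) = complex_of_real r *s v"
  unfolding vec_eq_iff vector_scaleR_component vector_smult_component by (simp add: scaleR_conv_of_real)

lemma scaleR_eq_smult_real: "r *\<^sub>R (v :: real^'k) = r *s v"
  by (simp add: vec_eq_iff)

lemma bounded_bilinear_heis_bracket:
  "bounded_bilinear (heis_bracket :: (complex, 'n::finite) heis \<Rightarrow> _)"
  unfolding bilinear_conv_bounded_bilinear[symmetric] bilinear_def
  by (auto intro!: linearI simp: heis_bracket_linear scaleR_eq_smult)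

lemma bounded_bilinear_heis_bracket_real:
  "bounded_bilinear (heis_bracket :: (real, 'n::finite) heis \<Rightarrow> _)"
  unfolding bilinear_conv_bounded_bilinear[symmetric] bilinear_def
  by (auto intro!: linearI simp: heis_bracket_linear scaleR_eq_smult_real)

lemma continuous_on_mult_heis_group [continuous_intros]:
  fixes f g :: "'a::topological_space \<Rightarrow> (complex, 'n::finite) heis"
  assumes "continuous_on S f" "continuous_on S g"
  shows "continuous_on S (\<lambda>x. f x \<otimes>\<^bsub>heis_group\<^esub> g x)"
proof -
  have "continuous_on S (\<lambda>x. f x + g x + (1/2) *\<^sub>R heis_bracket (f x) (g x))"
    by (intro continuous_intros assms bounded_bilinear.continuous_on[OF bounded_bilinear_heis_bracket])
  then show ?thesis
    by (simp add: mult_heis_group scaleR_eq_smult)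
qed

lemma mem_lcoset_heis_iff:
  fixes g :: "('a::field, 'n::finite) heis"
  assumes "subgroup K heis_group"
  shows "g' \<in> g <#\<^bsub>heis_group\<^esub> K \<longleftrightarrow> (- g) \<otimes>\<^bsub>heis_group\<^esub> g' \<in> K"
  using subgroup.lcos_module_imp[OF assms heis.is_group, of g g']
    subgroup.lcos_module_rev[OF assms heis.is_group, of g g'] by auto

lemma lcoset_heis_eq_iff:
  fixes g :: "('a::field, 'n::finite) heis"
  assumes "subgroup K heis_group"
  shows "g <#\<^bsub>heis_group\<^esub> K = g' <#\<^bsub>heis_group\<^esub> K \<longleftrightarrow> g' \<in> g <#\<^bsub>heis_group\<^esub> K"
  using heis.l_repr_independence[OF _ _ assms, of g' g] heis.lcos_self[OF _ assms, of g'] by auto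

lemma lcosets_heis: "lcosets\<^bsub>heis_group\<^esub> K = range (\<lambda>g. g <#\<^bsub>heis_group\<^esub> K)"
  by (auto simp: LCOSETS_def)

section \<open>Maps of coset spaces that lift to the group\<close>

text \<open>Holomorphic and antiholomorphic maps are treated together: \<open>\<tau>\<close> is the identity or the
  conjugation of \<open>\<complex>\<close>.\<close>

definition twisted_holomorphic_on ::
  "(complex \<Rightarrow> complex) \<Rightarrow> (complex^'k \<Rightarrow> complex^'l) \<Rightarrow> (complex^'k) set \<Rightarrow> bool" where
  "twisted_holomorphic_on \<tau> f V \<longleftrightarrow>
     (\<forall>x\<in>V. \<exists>f'. (f has_derivative f') (at x within V) \<and> (\<forall>c v. f' (c *s v) = \<tau> c *s f' v))"

lemma holomorphic_vec_on_twisted: "holomorphic_vec_on = twisted_holomorphic_on (\<lambda>c. c)"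
  by (simp add: fun_eq_iff holomorphic_vec_on_def twisted_holomorphic_on_def)

lemma antiholomorphic_vec_on_twisted: "antiholomorphic_vec_on = twisted_holomorphic_on cnj"
  by (simp add: fun_eq_iff antiholomorphic_vec_on_def twisted_holomorphic_on_def)

lemma twisted_holomorphic_on_compose:
  assumes f: "twisted_holomorphic_on \<tau> f V" and g: "twisted_holomorphic_on \<rho> g W"
    and "f ` V \<subseteq> W"
  shows "twisted_holomorphic_on (\<rho> \<circ> \<tau>) (g \<circ> f) V"
  unfolding twisted_holomorphic_on_def
proof
  fix x assume x: "x \<in> V"
  from f x obtain f' where f': "(f has_derivative f') (at x within V)"
    "\<And>c v. f' (c *s v) = \<tau> c *s f' v"
    unfolding twisted_holomorphic_on_def by blast
  from g x \<open>f ` V \<subseteq> W\<close> obtain g' where g': "(g has_derivative g') (at (f x) within W)"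
    "\<And>c v. g' (c *s v) = \<rho> c *s g' v"
    unfolding twisted_holomorphic_on_def by blast
  have "(g \<circ> f has_derivative g' \<circ> f') (at x within V)"
    by (intro diff_chain_within f' has_derivative_subset[OF g'(1)] assms(3))
  then show "\<exists>h'. (g \<circ> f has_derivative h') (at x within V) \<and>
      (\<forall>c v. h' (c *s v) = (\<rho> \<circ> \<tau>) c *s h' v)"
    using f'(2) g'(2) by (intro exI[of _ "g' \<circ> f'"]) auto
qed

lemma twisted_holomorphic_on_subset:
  "twisted_holomorphic_on \<tau> f V \<Longrightarrow> U \<subseteq> V \<Longrightarrow> twisted_holomorphic_on \<tau> f U"
  unfolding twisted_holomorphic_on_def by (meson has_derivative_subset subsetD)

text \<open>
  Derivatives are taken within the set, so a derivative within \<open>N\<close> is one within \<open>V\<close> because \<open>N\<close>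
  is relatively open in \<open>V\<close>.
\<close>

lemma twisted_holomorphic_on_localI:
  assumes "\<And>x. x \<in> V \<Longrightarrow> \<exists>N g. x \<in> N \<and> openin (top_of_set V) N \<and>
    twisted_holomorphic_on \<tau> g N \<and> (\<forall>y\<in>N. f y = g y)"
  shows "twisted_holomorphic_on \<tau> f V"
  unfolding twisted_holomorphic_on_def
proof
  fix x assume "x \<in> V"
  from assms[OF this] obtain N g where N: "x \<in> N" "openin (top_of_set V) N"
    "twisted_holomorphic_on \<tau> g N" "\<forall>y\<in>N. f y = g y" by blast
  from N obtain g' where g': "(g has_derivative g') (at x within N)"
    "\<forall>c v. g' (c *s v) = \<tau> c *s g' v"
    unfolding twisted_holomorphic_on_def by blast
  from N(2) obtain T where T: "open T" "N = V \<inter> T" unfolding openin_open by blast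
  have "(f has_derivative g') (at x within N)"
    using N by (intro has_derivative_transform[OF _ _ g'(1)]) auto
  then have "(f has_derivative g') (at x within V)"
    using T N(1) at_within_nhd[of x T N V] by auto
  with g'(2) show "\<exists>f'. (f has_derivative f') (at x within V) \<and> (\<forall>c v. f' (c *s v) = \<tau> c *s f' v)"
    by blast
qed

lemma topspace_coset_topology [simp]:
  "topspace (coset_topology K) = lcosets\<^bsub>heis_group\<^esub> K"
proof -
  have "openin (coset_topology K) (lcosets\<^bsub>heis_group\<^esub> K)"
    by (auto simp: openin_coset_topology lcosets_heis)
  moreover have "topspace (coset_topology K) \<subseteq> lcosets\<^bsub>heis_group\<^esub> K"
    using openin_topspace[of "coset_topology K"] by (simp only: openin_coset_topology)
  ultimately show ?thesis
    by (auto dest: openin_subset)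
qed

lemma coset_in_topspace [simp]: "g <#\<^bsub>heis_group\<^esub> K \<in> lcosets\<^bsub>heis_group\<^esub> K"
  by (simp add: lcosets_heis)

lemma quotient_map_coset:
  "quotient_map euclidean (coset_topology K) (\<lambda>g. g <#\<^bsub>heis_group\<^esub> K)"
  unfolding quotient_map_def by (auto simp: lcosets_heis openin_coset_topology)

lemma continuous_map_coset:
  "continuous_map euclidean (coset_topology K) (\<lambda>g. g <#\<^bsub>heis_group\<^esub> K)"
  by (rule quotient_imp_continuous_map[OF quotient_map_coset])

lemma continuous_map_coset_lift:
  assumes "continuous_on UNIV F" and "\<And>g. f (g <#\<^bsub>heis_group\<^esub> K) = F g <#\<^bsub>heis_group\<^esub> K"
  shows "continuous_map (coset_topology K) (coset_topology K) f"
proof -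
  have "continuous_map euclidean (coset_topology K) ((\<lambda>g. g <#\<^bsub>heis_group\<^esub> K) \<circ> F)"
    using assms(1) by (intro continuous_map_compose[OF _ continuous_map_coset]) simp
  moreover have "(\<lambda>g. g <#\<^bsub>heis_group\<^esub> K) \<circ> F = f \<circ> (\<lambda>g. g <#\<^bsub>heis_group\<^esub> K)"
    by (auto simp: assms(2))
  ultimately show ?thesis
    by (simp add: continuous_compose_quotient_map_eq[OF quotient_map_coset])
qed

text \<open>Near a point of a chart the inverse of the chart is a holomorphic local section
  followed by the projection, so that a lift of \<open>f\<close> computes \<open>f\<close> in charts.\<close>

lemma twisted_holomorphic_coset_lift:
  fixes K :: "(complex, 'n::finite) heis set"
  assumes F: "twisted_holomorphic_on \<tau> F UNIV"
    and f: "\<And>g. f (g <#\<^bsub>heis_group\<^esub> K) = F g <#\<^bsub>heis_group\<^esub> K"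
    and U: "(U, \<phi>) \<in> coset_atlas K" and V: "(V, \<psi>) \<in> coset_atlas K"
  shows "twisted_holomorphic_on \<tau> (\<psi> \<circ> f \<circ> inv_into U \<phi>) (\<phi> ` {x \<in> U. f x \<in> V})"
proof (rule twisted_holomorphic_on_localI)
  let ?D = "\<phi> ` {x \<in> U. f x \<in> V}"
  let ?p = "\<lambda>g. g <#\<^bsub>heis_group\<^esub> K"
  fix w assume w: "w \<in> ?D"
  note U' = U[unfolded coset_atlas_def mem_Collect_eq prod.case complex_chart_def]
  from U' have "homeomorphic_map (subtopology (coset_topology K) U) (top_of_set (\<phi> ` U)) \<phi>"
    and "openin (coset_topology K) U"
    by simp_all
  then have inj: "inj_on \<phi> U"
    by (simp only: homeomorphic_map_def topspace_subtopology_subset[OF openin_subset])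
  from w have "w \<in> \<phi> ` U" by blast
  with U' obtain N s where N: "w \<in> N" "openin (top_of_set (\<phi> ` U)) N"
    and s: "holomorphic_vec_on s N" "\<And>v. v \<in> N \<Longrightarrow> ?p (s v) \<in> U \<and> \<phi> (?p (s v)) = v"
    by meson
  let ?N = "N \<inter> ?D"
  have sinv: "inv_into U \<phi> v = ?p (s v)" if "v \<in> N" for v
    using inv_into_f_f[OF inj, of "?p (s v)"] s(2)[OF that] by simp
  have sV: "?p (F (s v)) \<in> V" if "v \<in> ?N" for v
  proof -
    from that have "v \<in> ?D" by (rule IntD2)
    then obtain x where "x \<in> U" "f x \<in> V" "v = \<phi> x" by (elim imageE CollectE conjE)
    have "x = inv_into U \<phi> v"
      using \<open>v = \<phi> x\<close> inv_into_f_f[OF inj \<open>x \<in> U\<close>] by (simp only:)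
    also have "\<dots> = ?p (s v)"
      using that by (intro sinv) (rule IntD1)
    finally have "f x = ?p (F (s v))"
      by (simp only: f)
    with \<open>f x \<in> V\<close> show ?thesis by (simp only:)
  qed
  have 1: "twisted_holomorphic_on (\<lambda>c. c) s ?N"
    using s(1) by (auto simp: holomorphic_vec_on_twisted intro: twisted_holomorphic_on_subset)
  have 2: "twisted_holomorphic_on (\<lambda>c. c) (\<lambda>g. \<psi> (?p g)) {g. ?p g \<in> V}"
    using V by (auto simp: coset_atlas_def holomorphic_vec_on_twisted)
  have "twisted_holomorphic_on ((\<lambda>c. c) \<circ> (\<tau> \<circ> (\<lambda>c. c))) ((\<lambda>g. \<psi> (?p g)) \<circ> (F \<circ> s)) ?N"
    by (rule twisted_holomorphic_on_compose[OF twisted_holomorphic_on_compose[OF 1 F] 2])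
      (use sV in auto)
  then have "twisted_holomorphic_on \<tau> ((\<lambda>g. \<psi> (?p g)) \<circ> (F \<circ> s)) ?N"
    by (simp add: comp_def)
  moreover have "openin (top_of_set ?D) ?N"
  proof -
    from N(2) obtain T where T: "open T" "N = \<phi> ` U \<inter> T" unfolding openin_open by blast
    then have "?N = ?D \<inter> T" by blast
    with T(1) show ?thesis unfolding openin_open by blast
  qed
  moreover have "\<forall>v\<in>?N. (\<psi> \<circ> f \<circ> inv_into U \<phi>) v = ((\<lambda>g. \<psi> (?p g)) \<circ> (F \<circ> s)) v"
    by (simp add: sinv f)
  ultimately show "\<exists>N g. w \<in> N \<and> openin (top_of_set ?D) N \<and> twisted_holomorphic_on \<tau> g N \<and>
      (\<forall>y\<in>N. (\<psi> \<circ> f \<circ> inv_into U \<phi>) y = g y)"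
    using N(1) w by (intro exI[of _ ?N] exI[of _ "(\<lambda>g. \<psi> (?p g)) \<circ> (F \<circ> s)"]) (intro conjI IntI)
qed

lemma holomorphic_map_coset_lift:
  assumes "continuous_on UNIV F" and "twisted_holomorphic_on (\<lambda>c. c) F UNIV"
    and "\<And>g. f (g <#\<^bsub>heis_group\<^esub> K) = F g <#\<^bsub>heis_group\<^esub> K"
  shows "holomorphic_map (coset_topology K) (coset_atlas K) (coset_topology K) (coset_atlas K) f"
  unfolding holomorphic_map_def holomorphic_vec_on_twisted
  using continuous_map_coset_lift[OF assms(1,3)] twisted_holomorphic_coset_lift[OF assms(2,3)]
  by blast

lemma antiholomorphic_map_coset_lift:
  assumes "continuous_on UNIV F" and "twisted_holomorphic_on cnj F UNIV"
    and "\<And>g. f (g <#\<^bsub>heis_group\<^esub> K) = F g <#\<^bsub>heis_group\<^esub> K"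
  shows "antiholomorphic_map (coset_topology K) (coset_atlas K) (coset_topology K) (coset_atlas K) f"
  unfolding antiholomorphic_map_def antiholomorphic_vec_on_twisted
  using continuous_map_coset_lift[OF assms(1,3)] twisted_holomorphic_coset_lift[OF assms(2,3)]
  by blast

section \<open>A global chart of the homogeneous space\<close>

text \<open>
  \<open>P\<close> is a complex-linear projection along the subalgebra \<open>K\<close>. The last assumption says that \<open>P\<close> maps
  the line spanned by \<open>Z\<close> into the centre. It makes all iterated brackets in the computations below vanish,
  also those that pass through \<open>P\<close>.
\<close>

locale coset_slice =
  fixes K :: "(complex, 'n::finite) heis set" and P :: "(complex, 'n) heis \<Rightarrow> (complex, 'n) heis"
  assumes P_add: "P (u + v) = P u + P v"
    and P_scale: "P (c *s v) = c *s P v"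
    and P_idem [simp]: "P (P v) = P v"
    and P_kernel: "P v = 0 \<longleftrightarrow> v \<in> K"
    and bracket_closed: "u \<in> K \<Longrightarrow> v \<in> K \<Longrightarrow> heis_bracket u v \<in> K"
    and P_bracket_central [simp]: "heis_bracket (P (heis_bracket u v)) w = 0"
begin

lemma P_diff: "P (u - v) = P u - P v"
  using P_add[of u "- v"] P_scale[of "-1" v] by simp

lemma P_minus: "P (- v) = - P v"
  using P_scale[of "-1" v] by simp

lemma P_zero [simp]: "P 0 = 0"
  using P_scale[of 0] by simp

lemma bounded_linear_P: "bounded_linear P"
  unfolding linear_conv_bounded_linear[symmetric]
  by (rule linearI) (simp_all add: P_add P_scale scaleR_eq_smult)

lemma P_bracket_central' [simp]: "heis_bracket w (P (heis_bracket u v)) = 0"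
  using heis_bracket_antisym[of w "P (heis_bracket u v)"] by simp

lemma subgroup_K: "subgroup K heis_group"
proof (rule subgroup.intro)
  show "\<one>\<^bsub>heis_group\<^esub> \<in> K"
    using P_kernel[of 0] by simp
next
  fix u v assume "u \<in> K" "v \<in> K"
  then show "u \<otimes>\<^bsub>heis_group\<^esub> v \<in> K"
    using bracket_closed[of u v] by (simp add: mult_heis_group P_add P_scale flip: P_kernel)
next
  fix u assume "u \<in> K"
  then show "inv\<^bsub>heis_group\<^esub> u \<in> K"
    by (simp add: P_minus flip: P_kernel)
qed simp

text \<open>
  If \<open>w = c \<otimes> k\<close> with \<open>P c = c\<close> and \<open>k \<in> K\<close>, then \<open>P w = c + P [c, k] / 2\<close>. Up to central elements
  \<open>c\<close> is \<open>P w\<close> and \<open>k\<close> is \<open>w - P w\<close>, so that \<open>[c, k] = [P w, w]\<close>. Hence \<open>slice w\<close> is the only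
  candidate for \<open>c\<close>.
\<close>

definition slice :: "(complex, 'n) heis \<Rightarrow> (complex, 'n) heis" where
  "slice w = P (w - (1/2) *s heis_bracket (P w) w)"

lemma P_slice [simp]: "P (slice w) = slice w"
  by (simp add: slice_def)

lemma slice_fixed: "P w = w \<Longrightarrow> slice w = w"
  by (simp add: slice_def)

text \<open>
  Replacing \<open>w\<close> by \<open>w \<otimes> k\<close> adds \<open>P [w - P w, k] / 2\<close> to the value, and this is zero because both
  arguments of the bracket lie in the subalgebra \<open>K\<close>.
\<close>

lemma slice_mult:
  assumes "k \<in> K"
  shows "slice (w \<otimes>\<^bsub>heis_group\<^esub> k) = slice w"
proof -
  have "P k = 0" using assms by (simp add: P_kernel)
  then have *: "P (w \<otimes>\<^bsub>heis_group\<^esub> k) = P w + (1/2) *s P (heis_bracket w k)"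
    by (simp add: mult_heis_group P_add P_scale)
  \<comment> \<open>The difference of \<open>w\<close> and \<open>P w\<close> lies in \<open>K\<close>, hence so does its bracket with \<open>k\<close>.\<close>
  have "P (w - P w) = 0" by (simp add: P_diff)
  then have "P (heis_bracket (w - P w) k) = 0"
    using assms by (simp add: P_kernel bracket_closed)
  then have "P (heis_bracket w k) = P (heis_bracket (P w) k)"
    by (simp add: heis_bracket_diff P_diff)
  then show ?thesis
    unfolding slice_def P_diff P_scale * mult_heis_group
    using \<open>P k = 0\<close> by (simp add: heis_bracket_linear P_add P_scale vec.scale_right_distrib)
qed

text \<open>
  By the kernel condition it suffices that \<open>P\<close> annihilates \<open>(- w) \<otimes> slice w\<close>; the two quadratic
  terms that arise are opposite by antisymmetry.
\<close>

lemma slice_in_coset: "slice w \<in> w <#\<^bsub>heis_group\<^esub> K"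
proof -
  have s: "slice w = P w - (1/2) *s P (heis_bracket (P w) w)"
    by (simp add: slice_def P_diff P_scale)
  have "heis_bracket w (slice w) = heis_bracket w (P w)"
    by (simp add: s heis_bracket_diff heis_bracket_linear)
  then have "P ((- w) \<otimes>\<^bsub>heis_group\<^esub> slice w) =
      - P w + slice w - (1/2) *s P (heis_bracket w (P w))"
    by (simp add: mult_heis_group P_add P_diff P_minus P_scale)
  also have "\<dots> = 0"
    unfolding s heis_bracket_antisym[of w "P w"] P_minus by simp
  finally show ?thesis
    by (simp add: mem_lcoset_heis_iff[OF subgroup_K] P_kernel)
qed

lemma coset_slice_eq: "slice w <#\<^bsub>heis_group\<^esub> K = w <#\<^bsub>heis_group\<^esub> K"
  using slice_in_coset[of w] lcoset_heis_eq_iff[OF subgroup_K, of w "slice w"] by simp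

definition slice_chart :: "(complex, 'n) heis set \<Rightarrow> (complex, 'n) heis" where
  "slice_chart C = slice (SOME g. g \<in> C)"

lemma slice_chart_coset: "slice_chart (g <#\<^bsub>heis_group\<^esub> K) = slice g"
proof -
  have "(SOME g'. g' \<in> g <#\<^bsub>heis_group\<^esub> K) \<in> g <#\<^bsub>heis_group\<^esub> K"
    by (rule someI, rule slice_in_coset)
  then obtain k where "k \<in> K" "(SOME g'. g' \<in> g <#\<^bsub>heis_group\<^esub> K) = g \<otimes>\<^bsub>heis_group\<^esub> k"
    unfolding l_coset_def by blast
  then show ?thesis
    by (simp add: slice_chart_def slice_mult)
qed

lemma coset_slice_chart:
  assumes "C \<in> lcosets\<^bsub>heis_group\<^esub> K"
  shows "slice_chart C <#\<^bsub>heis_group\<^esub> K = C"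
  using assms by (auto simp: lcosets_heis slice_chart_coset coset_slice_eq)

lemma slice_has_derivative:
  "(slice has_derivative
     (\<lambda>v. P (v - (1/2) *s (heis_bracket (P w) v + heis_bracket (P v) w)))) (at w within V)"
  unfolding slice_def
  by (rule bounded_linear.has_derivative[OF bounded_linear_P])
    (auto simp: scaleR_eq_smult[of "1/2", simplified, symmetric] scaleR_right_distrib
      intro!: derivative_eq_intros bounded_linear_imp_has_derivative bounded_linear_P
        bounded_bilinear.FDERIV[OF bounded_bilinear_heis_bracket])

lemma holomorphic_slice: "holomorphic_vec_on slice V"
  unfolding holomorphic_vec_on_def
proof
  fix w
  have "P (c *s v - (1/2) *s (heis_bracket (P w) (c *s v) + heis_bracket (P (c *s v)) w)) =
      c *s P (v - (1/2) *s (heis_bracket (P w) v + heis_bracket (P v) w))" for c v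
    by (simp add: heis_bracket_linear P_scale P_add P_diff vec.scale_right_distrib
        vec.scale_right_diff_distrib mult.commute)
  then show "\<exists>f'. (slice has_derivative f') (at w within V) \<and> (\<forall>c v. f' (c *s v) = c *s f' v)"
    using slice_has_derivative[of w V] by blast
qed

lemma continuous_on_slice: "continuous_on V slice"
  using slice_has_derivative by (intro has_derivative_continuous_on)

lemma range_slice: "range slice = range P"
proof
  show "range slice \<subseteq> range P" by (auto simp: slice_def)
  show "range P \<subseteq> range slice" using slice_fixed[OF P_idem] by (auto intro: range_eqI[OF sym])
qed

lemma slice_chart_image: "slice_chart ` (lcosets\<^bsub>heis_group\<^esub> K) = range P"
  by (simp add: lcosets_heis image_image slice_chart_coset range_slice)

lemma continuous_map_slice_chart: "continuous_map (coset_topology K) euclidean slice_chart"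
  using continuous_on_slice[of UNIV]
  by (simp add: continuous_compose_quotient_map_eq[OF quotient_map_coset, symmetric]
      comp_def slice_chart_coset)

lemma homeomorphic_maps_slice_chart:
  "homeomorphic_maps (coset_topology K) (top_of_set (range P)) slice_chart (\<lambda>g. g <#\<^bsub>heis_group\<^esub> K)"
  unfolding homeomorphic_maps_def
proof (intro conjI ballI)
  show "continuous_map (coset_topology K) (top_of_set (range P)) slice_chart"
    using continuous_map_slice_chart slice_chart_image
    by (auto simp: continuous_map_in_subtopology)
  show "continuous_map (top_of_set (range P)) (coset_topology K) (\<lambda>g. g <#\<^bsub>heis_group\<^esub> K)"
    by (rule continuous_map_from_subtopology[OF continuous_map_coset])
qed (auto simp: coset_slice_chart slice_chart_coset slice_fixed)

lemma homeomorphic_space_slice: "coset_topology K homeomorphic_space top_of_set (range P)"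
  using homeomorphic_maps_slice_chart unfolding homeomorphic_space_def by blast

lemma homeomorphic_map_slice_chart:
  "homeomorphic_map (coset_topology K) (top_of_set (range P)) slice_chart"
  using homeomorphic_maps_slice_chart homeomorphic_maps_map by blast

lemma subspace_range_P: "vec.subspace (range P)"
  unfolding vec.subspace_def
proof (intro conjI ballI allI)
  show "0 \<in> range P" using P_zero by (metis rangeI)
next
  fix x y assume "x \<in> range P" "y \<in> range P"
  then show "x + y \<in> range P" using P_add by (metis (no_types, lifting) imageE rangeI)
next
  fix c x assume "x \<in> range P"
  then show "c *s x \<in> range P" using P_scale by (metis (no_types, lifting) imageE rangeI)
qed

text \<open>
  The inverse of the chart is the projection restricted to the range of \<open>P\<close>; the section
  required by the atlas is therefore the identity.
\<close>

lemma slice_chart_in_atlas: "(lcosets\<^bsub>heis_group\<^esub> K, slice_chart) \<in> coset_atlas K"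
  unfolding coset_atlas_def mem_Collect_eq prod.case
proof (intro conjI ballI)
  have "subtopology (coset_topology K) (lcosets\<^bsub>heis_group\<^esub> K) = coset_topology K"
    by (metis subtopology_topspace topspace_coset_topology)
  then show "complex_chart (coset_topology K) (lcosets\<^bsub>heis_group\<^esub> K, slice_chart)"
    using subspace_range_P homeomorphic_map_slice_chart openin_topspace[of "coset_topology K"]
    unfolding complex_chart_def prod.case slice_chart_image
    by (auto intro!: exI[of _ "range P"])
  show "holomorphic_vec_on (\<lambda>g. slice_chart (g <#\<^bsub>heis_group\<^esub> K))
      {g. g <#\<^bsub>heis_group\<^esub> K \<in> lcosets\<^bsub>heis_group\<^esub> K}"
    using holomorphic_slice by (simp add: slice_chart_coset)
next
  fix w
  let ?W = "slice_chart ` (lcosets\<^bsub>heis_group\<^esub> K)"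
  assume "w \<in> ?W"
  moreover have "holomorphic_vec_on (\<lambda>v. v) ?W"
    unfolding holomorphic_vec_on_def by (auto intro!: exI[of _ "\<lambda>v. v"])
  moreover have "\<forall>v\<in>?W. v <#\<^bsub>heis_group\<^esub> K \<in> lcosets\<^bsub>heis_group\<^esub> K \<and> slice_chart (v <#\<^bsub>heis_group\<^esub> K) = v"
    by (auto simp: slice_chart_image slice_chart_coset slice_fixed)
  ultimately show "\<exists>N (s :: (complex, 'n) heis \<Rightarrow> (complex, 'n) heis).
      w \<in> N \<and> openin (top_of_set ?W) N \<and> holomorphic_vec_on s N \<and>
      (\<forall>v\<in>N. s v <#\<^bsub>heis_group\<^esub> K \<in> lcosets\<^bsub>heis_group\<^esub> K \<and> slice_chart (s v <#\<^bsub>heis_group\<^esub> K) = v)"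
    by (intro exI[of _ ?W] exI[of _ "\<lambda>v. v"]) auto
qed

lemma connected_space_coset: "connected_space (coset_topology K)"
proof -
  have "connected_space (euclidean :: (complex, 'n) heis topology)"
    using connectedin_topspace[of "euclidean :: (complex, 'n) heis topology"]
    by (simp add: connected_UNIV)
  then show ?thesis
    by (rule connected_space_quotient_map_image[OF quotient_map_coset])
qed

lemma twisted_holomorphic_id: "twisted_holomorphic_on (\<lambda>c. c) (\<lambda>v. v) V"
  unfolding twisted_holomorphic_on_def by (auto intro!: exI[of _ "\<lambda>v. v"])

text \<open>
  The topological properties are inherited from the vector space \<open>range P\<close>. A transition map is the
  identity of the homogeneous space in charts, so it is holomorphic by the lifting lemma with the
  identity as lift.
\<close>

lemma complex_manifold_coset: "complex_manifold (coset_topology K) (coset_atlas K)"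
  unfolding complex_manifold_def
proof (intro conjI)
  show "Hausdorff_space (coset_topology K)"
    using homeomorphic_Hausdorff_space[OF homeomorphic_space_slice]
    by (simp add: Hausdorff_space_subtopology)
  have "second_countable (euclidean :: (complex, 'n) heis topology)"
    unfolding second_countable_def using univ_second_countable
    by (metis (no_types, opaque_lifting) UnionE Union_upper in_mono open_openin)
  then show "second_countable (coset_topology K)"
    using homeomorphic_space_second_countability[OF homeomorphic_space_slice]
    by (simp add: second_countable_subtopology)
  show "\<forall>c\<in>coset_atlas K. complex_chart (coset_topology K) c"
    by (auto simp: coset_atlas_def)
  show "(\<Union>(U, \<phi>)\<in>coset_atlas K. U) = topspace (coset_topology K)"
  proof
    have "U \<subseteq> topspace (coset_topology K)" if "(U, \<phi>) \<in> coset_atlas K" for U \<phi>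
      using that unfolding coset_atlas_def mem_Collect_eq prod.case complex_chart_def
      by (intro openin_subset) simp
    then show "(\<Union>(U, \<phi>)\<in>coset_atlas K. U) \<subseteq> topspace (coset_topology K)"
      by blast
    show "topspace (coset_topology K) \<subseteq> (\<Union>(U, \<phi>)\<in>coset_atlas K. U)"
      using slice_chart_in_atlas by (auto simp only: topspace_coset_topology)
  qed
  have "holomorphic_vec_on (\<psi> \<circ> inv_into U \<phi>) (\<phi> ` (U \<inter> V))"
    if "(U, \<phi>) \<in> coset_atlas K" "(V, \<psi>) \<in> coset_atlas K" for U V \<phi> \<psi>
    using twisted_holomorphic_coset_lift[OF twisted_holomorphic_id _ that, of "\<lambda>C. C"]
    by (simp add: holomorphic_vec_on_twisted comp_def Int_def)
  then show "\<forall>(U, \<phi>)\<in>coset_atlas K. \<forall>(V, \<psi>)\<in>coset_atlas K.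
      holomorphic_vec_on (\<psi> \<circ> inv_into U \<phi>) (\<phi> ` (U \<inter> V))"
    by blast
qed

end

section \<open>The action by left translations\<close>

lemma lcoset_lcoset_heis:
  fixes g :: "('a::field, 'n::finite) heis"
  shows "g <#\<^bsub>heis_group\<^esub> (g' <#\<^bsub>heis_group\<^esub> K) = (g \<otimes>\<^bsub>heis_group\<^esub> g') <#\<^bsub>heis_group\<^esub> K"
  by (simp add: heis.lcos_m_assoc)

lemma zero_mult_heis: "0 \<otimes>\<^bsub>heis_group\<^esub> g = g"
  by (simp add: mult_heis_group)

lemma left_translation_coset:
  "left_translation K l (g <#\<^bsub>heis_group\<^esub> K) = (cvec l \<otimes>\<^bsub>heis_group\<^esub> g) <#\<^bsub>heis_group\<^esub> K"
  by (simp add: left_translation_def lcoset_lcoset_heis)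

lemma cvec_0 [simp]: "cvec 0 = 0"
  by (simp add: cvec_def vec_eq_iff)

lemma cvec_add: "cvec (u + v) = cvec u + cvec v"
  by (simp add: cvec_def vec_eq_iff)

lemma cvec_minus: "cvec (- v) = - cvec v"
  by (simp add: cvec_def vec_eq_iff)

lemma cvec_diff: "cvec (u - v) = cvec u - cvec v"
  by (simp add: cvec_def vec_eq_iff)

lemma cvec_scale: "cvec (c *s v) = complex_of_real c *s cvec v"
  by (simp add: cvec_def vec_eq_iff)

lemma cvec_Z [simp]: "cvec heis_Z = heis_Z"
  by (simp add: cvec_def vec_eq_iff heis_Z_def axis_def)

lemma heis_bracket_cvec: "heis_bracket (cvec u) (cvec v) = cvec (heis_bracket u v)"
  unfolding heis_bracket_def cvec_scale cvec_Z by (simp add: cvec_def)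

lemma mult_cvec: "cvec u \<otimes>\<^bsub>heis_group\<^esub> cvec v = cvec (u \<otimes>\<^bsub>heis_group\<^esub> v)"
  by (simp add: mult_heis_group heis_bracket_cvec cvec_add cvec_scale)

lemma bounded_linear_cvec: "bounded_linear cvec"
  unfolding linear_conv_bounded_linear[symmetric]
  by (rule linearI) (simp_all add: cvec_add cvec_scale scaleR_eq_smult scaleR_eq_smult_real)

text \<open>
  \<open>left_translation\<close> is restricted to the set of cosets, as the group of bijections requires; the
  inverse of a translation is the translation by \<open>- l\<close>.
\<close>

lemma group_action_left_translation:
  fixes K :: "(complex, 'n::finite) heis set"
  shows "group_action heis_group (lcosets\<^bsub>heis_group\<^esub> K) (left_translation K)"
proof -
  let ?X = "lcosets\<^bsub>heis_group\<^esub> K"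
  let ?act = "left_translation K"
  have act: "?act l (?act l' C) = ?act (l \<otimes>\<^bsub>heis_group\<^esub> l') C" if "C \<in> ?X" for l l' C
    using that
    by (auto simp: lcosets_heis left_translation_coset heis.m_assoc simp flip: mult_cvec)
  have id: "?act 0 C = C" if "C \<in> ?X" for C
    using that
    by (auto simp: lcosets_heis left_translation_coset zero_mult_heis)
  have closed: "?act l C \<in> ?X" if "C \<in> ?X" for l C
    using that by (auto simp: lcosets_heis left_translation_coset)
  have bij: "?act l \<in> Bij ?X" for l
  proof -
    have "bij_betw (?act l) ?X ?X"
      by (rule bij_betw_byWitness[where f' = "?act (- l)"])
        (auto simp: act closed mult_heis_group id)
    then show ?thesis
      by (simp add: Bij_def left_translation_def)
  qed
  have "?act \<in> hom heis_group (BijGroup ?X)"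
  proof (rule homI)
    fix l l' :: "(real, 'n) heis"
    have "?act (l \<otimes>\<^bsub>heis_group\<^esub> l') = compose ?X (?act l) (?act l')"
      by (rule extensionalityI[of _ ?X])
        (auto simp: compose_def act left_translation_def[of K "l \<otimes>\<^bsub>heis_group\<^esub> l'"])
    then show "?act (l \<otimes>\<^bsub>heis_group\<^esub> l') = ?act l \<otimes>\<^bsub>BijGroup ?X\<^esub> ?act l'"
      by (simp add: BijGroup_def bij)
  qed (simp add: BijGroup_def bij)
  then show ?thesis
    by (simp add: group_action_def group_hom_def group_hom_axioms_def group_BijGroup heis.is_group)
qed

context coset_slice
begin

lemma holomorphic_action_left_translation:
  "holomorphic_action heis_group euclidean (left_translation K) (coset_topology K) (coset_atlas K)"
  unfolding holomorphic_action_def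
proof (intro conjI ballI)
  show "group_action heis_group (topspace (coset_topology K)) (left_translation K)"
    by (simp add: group_action_left_translation)
  show "holomorphic_map (coset_topology K) (coset_atlas K) (coset_topology K) (coset_atlas K)
      (left_translation K l)" for l
  proof (rule holomorphic_map_coset_lift[where F = "\<lambda>g. cvec l \<otimes>\<^bsub>heis_group\<^esub> g"])
    show "continuous_on UNIV (\<lambda>g. cvec l \<otimes>\<^bsub>heis_group\<^esub> g)"
      by (intro continuous_intros)
    have "((\<lambda>g. cvec l \<otimes>\<^bsub>heis_group\<^esub> g) has_derivative
        (\<lambda>v. v + (1/2) *s heis_bracket (cvec l) v)) (at x within V)" for x V
      unfolding mult_heis_group
      by (auto simp: scaleR_eq_smult[of "1/2", simplified, symmetric] scaleR_right_distrib
          intro!: derivative_eq_intros bounded_linear_imp_has_derivative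
            bounded_bilinear.bounded_linear_right[OF bounded_bilinear_heis_bracket])
    then show "twisted_holomorphic_on (\<lambda>c. c) (\<lambda>g. cvec l \<otimes>\<^bsub>heis_group\<^esub> g) UNIV"
      unfolding twisted_holomorphic_on_def
      by (intro ballI exI conjI) (auto simp: heis_bracket_linear vec.scale_right_distrib mult.commute)
  qed (rule left_translation_coset)
  \<comment> \<open>The action is jointly continuous because the global chart is a continuous section.\<close>
  have "continuous_map (prod_topology euclidean (coset_topology K)) euclidean
      (\<lambda>x. slice_chart (snd x))"
    using continuous_map_compose[OF continuous_map_snd continuous_map_slice_chart]
    by (simp only: comp_def)
  then have "continuous_map (prod_topology euclidean (coset_topology K)) (prod_topology euclidean euclidean)
      (\<lambda>x. (fst x :: (real, 'n) heis, slice_chart (snd x)))"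
    by (intro continuous_map_pairedI continuous_map_fst)
  moreover have "continuous_on UNIV
      (\<lambda>p :: (real, 'n) heis \<times> (complex, 'n) heis. cvec (fst p) \<otimes>\<^bsub>heis_group\<^esub> snd p)"
    by (intro continuous_intros bounded_linear.continuous_on[OF bounded_linear_cvec])
  then have "continuous_map (prod_topology euclidean euclidean) euclidean
      (\<lambda>p :: (real, 'n) heis \<times> (complex, 'n) heis. cvec (fst p) \<otimes>\<^bsub>heis_group\<^esub> snd p)"
    by (simp add: euclidean_product_topology)
  ultimately have "continuous_map (prod_topology euclidean (coset_topology K)) (coset_topology K)
      ((\<lambda>g. g <#\<^bsub>heis_group\<^esub> K) \<circ> ((\<lambda>p. cvec (fst p) \<otimes>\<^bsub>heis_group\<^esub> snd p) \<circ>
        (\<lambda>x. (fst x :: (real, 'n) heis, slice_chart (snd x)))))"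
    by (intro continuous_map_compose[OF _ continuous_map_coset] continuous_map_compose)
  then show "continuous_map (prod_topology euclidean (coset_topology K)) (coset_topology K)
      (\<lambda>(l, x). left_translation K l x)"
    by (rule continuous_map_eq)
      (auto simp: coset_slice_chart simp flip: left_translation_coset)
qed simp

end

section \<open>Slices as real submanifolds\<close>

lemma Ck_on_const: "Ck_on k (\<lambda>x. c) V"
  by (induction k arbitrary: c) (auto intro!: exI[of _ "\<lambda>x v. 0"])

text \<open>
  The function is only required to agree with the identity on \<open>V\<close>, so that the lemma covers
  \<open>inv_into\<close> of the identity.
\<close>

lemma smooth_on_id:
  assumes "\<And>x. x \<in> V \<Longrightarrow> f x = x"
  shows "smooth_on f V"
  unfolding smooth_on_def
proof
  fix k
  show "Ck_on k f V"
  proof (cases k)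
    case 0
    then show ?thesis
      using continuous_on_cong[of V V f "\<lambda>x. x"] assms by (simp add: continuous_on_id)
  next
    case (Suc j)
    have "(f has_derivative (\<lambda>v. v)) (at x within V)" if "x \<in> V" for x
      by (rule has_derivative_transform[OF that]) (auto simp: assms)
    then show ?thesis
      using Suc Ck_on_const by (auto intro!: exI[of _ "\<lambda>x v. v"])
  qed
qed

text \<open>
  In the global chart the set is already an open piece of the linear subspace \<open>R\<close>, so that the
  identity serves as straightening map.
\<close>

lemma (in coset_slice) real_submanifold_slice:
  assumes R: "subspace R" "R \<subseteq> range P" and "open T"
  shows "real_submanifold (coset_topology K) (coset_atlas K)
    ((\<lambda>g. g <#\<^bsub>heis_group\<^esub> K) ` (R \<inter> T))"
    (is "real_submanifold _ _ ?S")
proof -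
  let ?X = "lcosets\<^bsub>heis_group\<^esub> K"
  let ?N = "range P \<inter> T"
  have fixed: "slice_chart (g <#\<^bsub>heis_group\<^esub> K) = g" if "g \<in> R" for g
    using that R(2) by (auto simp: slice_chart_coset slice_fixed)
  have S: "?S \<subseteq> ?X" by auto
  have "slice_chart ` ?S = R \<inter> T"
    using fixed by (force simp: image_image)
  then have S': "slice_chart ` (?S \<inter> ?X) = R \<inter> T"
    using S by (simp add: Int_absorb2)
  have W: "subspace (range P)"
    using linear_subspace_image[OF bounded_linear.linear[OF bounded_linear_P] subspace_UNIV] .
  have N: "openin (top_of_set (range P)) ?N"
    using \<open>open T\<close> by (rule openin_open_Int)
  have inv: "inv_into ?N (\<lambda>v. v) x = x" if "x \<in> ?N" for x
    using inv_into_f_f[of "\<lambda>v. v" ?N x] that by (simp add: inj_on_def)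
  have "slice_chart p \<in> ?N" if "p \<in> ?S" for p
    using that fixed R(2) by auto
  then have chart: "\<exists>N (\<Phi> :: (complex, 'n) heis \<Rightarrow> (complex, 'n) heis) W Q.
      slice_chart p \<in> N \<and> openin (top_of_set (slice_chart ` ?X)) N \<and>
      subspace W \<and> openin (top_of_set W) (\<Phi> ` N) \<and>
      inj_on \<Phi> N \<and> smooth_on \<Phi> N \<and> smooth_on (inv_into N \<Phi>) (\<Phi> ` N) \<and>
      subspace Q \<and> Q \<subseteq> W \<and> dim Q = dim R \<and>
      \<Phi> ` (N \<inter> slice_chart ` (?S \<inter> ?X)) = \<Phi> ` N \<inter> Q" if "p \<in> ?S" for p
    unfolding slice_chart_image S'
    using that W N R
    by (intro exI[of _ ?N] exI[of _ "\<lambda>v. v"] exI[of _ "range P"] exI[of _ R])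
      (auto simp: inj_on_def inv intro!: smooth_on_id)
  show ?thesis
    unfolding real_submanifold_def
    using S chart slice_chart_in_atlas
    by (intro conjI exI[of _ "dim R"] ballI bexI[of _ "(?X, slice_chart)"])
      (simp_all only: topspace_coset_topology prod.case, auto)
qed

section \<open>Complexification\<close>

definition re_vec :: "complex^'k \<Rightarrow> real^'k" where "re_vec w = (\<chi> j. Re (w $ j))"
definition im_vec :: "complex^'k \<Rightarrow> real^'k" where "im_vec w = (\<chi> j. Im (w $ j))"

lemma re_vec_simps [simp]:
  "re_vec (u + v) = re_vec u + re_vec v" "re_vec (u - v) = re_vec u - re_vec v"
  "re_vec (- v) = - re_vec v" "re_vec 0 = 0"
  "re_vec (cvec x) = x" "re_vec (c *s v) = Re c *\<^sub>R re_vec v - Im c *\<^sub>R im_vec v"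
  by (simp_all add: re_vec_def im_vec_def cvec_def vec_eq_iff)

lemma im_vec_simps [simp]:
  "im_vec (u + v) = im_vec u + im_vec v" "im_vec (u - v) = im_vec u - im_vec v"
  "im_vec (- v) = - im_vec v" "im_vec 0 = 0"
  "im_vec (cvec x) = 0" "im_vec (c *s v) = Re c *\<^sub>R im_vec v + Im c *\<^sub>R re_vec v"
  by (simp_all add: re_vec_def im_vec_def cvec_def vec_eq_iff)

lemma cvec_re_im: "cvec (re_vec w) + \<i> *s cvec (im_vec w) = w"
  by (simp add: re_vec_def im_vec_def cvec_def vec_eq_iff complex_eq_iff)

lemma re_im_eqI: "re_vec v = re_vec w \<Longrightarrow> im_vec v = im_vec w \<Longrightarrow> v = w"
  by (metis cvec_re_im)

lemma vec_eq_0_re_im: "w = 0 \<longleftrightarrow> re_vec w = 0 \<and> im_vec w = 0"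
  using re_im_eqI[of w 0] by auto

lemma cvec_scaleR: "cvec (c *\<^sub>R v) = complex_of_real c *s cvec v"
  by (simp add: cvec_def vec_eq_iff)

lemma re_im_Z [simp]: "re_vec heis_Z = heis_Z" "im_vec heis_Z = 0"
  using re_vec_simps(5)[of heis_Z] im_vec_simps(5)[of heis_Z] by simp_all

lemma continuous_on_im_vec: "continuous_on V im_vec"
  unfolding im_vec_def by (intro continuous_intros)

lemma bracket_re_im:
  "re_vec (heis_bracket u v) = heis_bracket (re_vec u) (re_vec v) - heis_bracket (im_vec u) (im_vec v)"
  "im_vec (heis_bracket u v) = heis_bracket (re_vec u) (im_vec v) + heis_bracket (im_vec u) (re_vec v)"
proof -
  have *: "heis_bracket u v =
      cvec (heis_bracket (re_vec u) (re_vec v)) - cvec (heis_bracket (im_vec u) (im_vec v))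
      + \<i> *s (cvec (heis_bracket (re_vec u) (im_vec v)) + cvec (heis_bracket (im_vec u) (re_vec v)))"
    by (subst cvec_re_im[of u, symmetric], subst cvec_re_im[of v, symmetric])
      (simp only: heis_bracket_linear heis_bracket_cvec, simp add: algebra_simps vec.scale_right_distrib)
  show
    "re_vec (heis_bracket u v) = heis_bracket (re_vec u) (re_vec v) - heis_bracket (im_vec u) (im_vec v)"
    "im_vec (heis_bracket u v) = heis_bracket (re_vec u) (im_vec v) + heis_bracket (im_vec u) (re_vec v)"
    by (simp_all add: *)
qed

lemma mem_complexification_iff: "w \<in> complexification V \<longleftrightarrow> re_vec w \<in> V \<and> im_vec w \<in> V"
proof
  show "w \<in> complexification V" if "re_vec w \<in> V \<and> im_vec w \<in> V"
    using that cvec_re_im[of w, symmetric] unfolding complexification_def by blast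
qed (auto simp: complexification_def)

definition complexify :: "(real^'k \<Rightarrow> real^'l) \<Rightarrow> complex^'k \<Rightarrow> complex^'l" where
  "complexify f w = cvec (f (re_vec w)) + \<i> *s cvec (f (im_vec w))"

lemma re_im_complexify [simp]:
  "re_vec (complexify f w) = f (re_vec w)" "im_vec (complexify f w) = f (im_vec w)"
  by (simp_all add: complexify_def)

lemma complexify_add: "linear f \<Longrightarrow> complexify f (u + v) = complexify f u + complexify f v"
  by (rule re_im_eqI) (simp_all add: linear_add)

lemma complexify_scale: "linear f \<Longrightarrow> complexify f (c *s v) = c *s complexify f v"
  by (rule re_im_eqI) (simp_all add: linear_add linear_diff linear_cmul)

section \<open>A projection and a functional adapted to a subspace and a vector\<close>

text \<open>
  Choose a basis of \<open>h\<close> that contains \<open>z\<close> if \<open>z \<in> h\<close>, and extend it together with \<open>z\<close> to a basis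
  of the whole space. Then \<open>P\<close> annihilates the basis vectors from \<open>h\<close> and fixes the others, and
  \<open>\<zeta>\<close> is the coordinate of \<open>z\<close>. Both cases \<open>z \<in> h\<close> and \<open>z \<notin> h\<close> are covered by the same
  construction.
\<close>

lemma exists_adapted_projection:
  fixes h :: "'a::real_vector set"
  assumes h: "subspace h" and z: "z \<noteq> 0"
  obtains P :: "'a \<Rightarrow> 'a" and \<zeta> :: "'a \<Rightarrow> real"
  where "linear P" "linear \<zeta>" "\<forall>x. P (P x) = P x" "\<forall>x. P x = 0 \<longleftrightarrow> x \<in> h" "\<zeta> z = 1"
    "z \<in> h \<longrightarrow> (\<forall>x. \<zeta> (P x) = 0)" "z \<notin> h \<longrightarrow> P z = z \<and> (\<forall>x\<in>h. \<zeta> x = 0)"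
proof -
  have "independent (h \<inter> {z})"
    using z by (cases "z \<in> h") (simp_all add: dependent_single independent_empty)
  then obtain B where B: "h \<inter> {z} \<subseteq> B" "B \<subseteq> h" "independent B" "h \<subseteq> span B"
    using maximal_independent_subset_extend[OF Int_lower1] by metis
  have spanB: "span B = h"
    using B(4) span_minimal[OF B(2) h] by blast
  have "independent (insert z B)"
  proof (cases "z \<in> h")
    case True
    then have "insert z B = B" using B by auto
    then show ?thesis using B by simp
  next
    case False
    then show ?thesis using B spanB by (simp add: independent_insert)
  qed
  then obtain B' where B': "insert z B \<subseteq> B'" "independent B'" and "UNIV \<subseteq> span B'"
    using maximal_independent_subset_extend[OF subset_UNIV] by metis
  then have spanB': "span B' = UNIV" by blast
  obtain P where P: "linear P" "\<And>x. x \<in> B' \<Longrightarrow> P x = (if x \<in> B then 0 else x)"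
    using linear_independent_extend[OF B'(2), of "\<lambda>x. if x \<in> B then 0 else x"] by auto
  obtain \<zeta> :: "'a \<Rightarrow> real"
    where \<zeta>: "linear \<zeta>" "\<And>x. x \<in> B' \<Longrightarrow> \<zeta> x = (if x = z then 1 else 0)"
    using linear_independent_extend[OF B'(2), of "\<lambda>x. if x = z then 1 else 0"] by auto
  have PB: "P x = 0" if "x \<in> B" for x
    using that B'(1) by (simp add: P(2) subset_iff)
  then have P0: "P x = 0" if "x \<in> h" for x
    using linear_eq_0_on_span[OF P(1), of B x] that spanB by blast
  have PP: "P (P x) = P x" for x
    using linear_eq_on_span[OF linear_compose[OF P(1) P(1)] P(1), of B' x] spanB'
    by (auto simp: P(2) P0 linear_0[OF P(1)])
  have "x - P x \<in> h" for x
  proof -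
    have "linear (\<lambda>x. x - P x)"
      using linear_compose_sub[OF linear_id P(1)] by (simp add: id_def)
    then have sub: "subspace {x. x - P x \<in> h}"
      using linear_subspace_vimage[of "\<lambda>x. x - P x" h] h by (simp add: vimage_def)
    have "B' \<subseteq> {x. x - P x \<in> h}"
      using B(2) subspace_0[OF h] by (auto simp: P(2))
    then have "span B' \<subseteq> {x. x - P x \<in> h}"
      using sub by (rule span_minimal)
    then show ?thesis using spanB' by auto
  qed
  then have ker: "P x = 0 \<longleftrightarrow> x \<in> h" for x
    using P0 by (metis diff_zero)
  show thesis
  proof (rule that[OF P(1) \<zeta>(1)]; (intro allI impI conjI ballI)?)
    show "P (P x) = P x" "P x = 0 \<longleftrightarrow> x \<in> h" for x
      by (rule PP, rule ker)
    show "\<zeta> z = 1" using B' by (simp add: \<zeta>(2))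
    show "\<zeta> (P x) = 0" if "z \<in> h" for x
    proof -
      have "z \<in> B" using that B by auto
      then show ?thesis
        using linear_eq_0_on_span[OF linear_compose[OF P(1) \<zeta>(1)], of B' x] spanB'
        by (auto simp: P(2) \<zeta>(2) linear_0[OF \<zeta>(1)])
    qed
    show "P z = z" if "z \<notin> h" using that B B' by (auto simp: P(2))
    show "\<zeta> x = 0" if "z \<notin> h" "x \<in> h" for x
    proof -
      have "\<zeta> b = 0" if "b \<in> B" for b
        using that \<open>z \<notin> h\<close> B(2) B'(1) by (subst \<zeta>(2)) auto
      then show ?thesis
        using linear_eq_0_on_span[OF \<zeta>(1), of B x] that(2) spanB by blast
    qed
  qed
qed

section \<open>Orbits, slice and involution\<close>

text \<open>
  A subalgebra with the data of \<open>exists_adapted_projection\<close> for \<open>z = Z\<close>. If \<open>Z \<in> h\<close>, the quotient by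
  \<open>h\<close> is abelian and \<open>range P\<close> represents it inside the kernel of \<open>\<zeta>\<close>; if \<open>Z \<notin> h\<close>, then \<open>h\<close> itself is
  abelian and lies in the kernel of \<open>\<zeta>\<close>, while \<open>Z\<close> lies in \<open>range P\<close>.
\<close>

locale adapted_subalgebra =
  fixes h :: "(real, 'n::finite) heis set"
    and P :: "(real, 'n) heis \<Rightarrow> (real, 'n) heis"
    and \<zeta> :: "(real, 'n) heis \<Rightarrow> real"
  assumes subspace_h: "subspace h"
    and bracket_h: "u \<in> h \<Longrightarrow> v \<in> h \<Longrightarrow> heis_bracket u v \<in> h"
    and linear_P: "linear P"
    and P_P: "P (P x) = P x"
    and P_eq_0_iff: "P x = 0 \<longleftrightarrow> x \<in> h"
    and linear_zeta: "linear \<zeta>"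
    and zeta_Z [simp]: "\<zeta> heis_Z = 1"
    and zeta_P: "heis_Z \<in> h \<Longrightarrow> \<zeta> (P x) = 0"
    and P_Z: "heis_Z \<notin> h \<Longrightarrow> P heis_Z = heis_Z"
    and zeta_h: "heis_Z \<notin> h \<Longrightarrow> x \<in> h \<Longrightarrow> \<zeta> x = 0"
begin

abbreviation K where "K \<equiv> complexification h"

text \<open>
  The bracket lies in \<open>h\<close> and on the line through \<open>Z\<close>, and these meet in zero.
\<close>

lemma bracket_h_zero:
  assumes "heis_Z \<notin> h" "u \<in> h" "v \<in> h"
  shows "heis_bracket u v = 0"
proof (rule ccontr)
  obtain c where c: "heis_bracket u v = c *s heis_Z" by (rule heis_bracket_in_Z)
  assume "heis_bracket u v \<noteq> 0"
  then have "c \<noteq> 0" using c by auto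
  have "(1/c) *\<^sub>R heis_bracket u v \<in> h"
    using assms by (intro subspace_scale subspace_h bracket_h)
  with c \<open>c \<noteq> 0\<close> assms(1) show False by (simp add: scaleR_eq_smult_real)
qed

sublocale coset_slice K "complexify P"
proof
  fix u v w :: "(complex, 'n) heis" and c
  show "complexify P (u + v) = complexify P u + complexify P v"
    "complexify P (c *s v) = c *s complexify P v"
    by (simp_all add: complexify_add complexify_scale linear_P)
  show "complexify P (complexify P v) = complexify P v"
    by (rule re_im_eqI) (simp_all add: P_P)
  show "complexify P v = 0 \<longleftrightarrow> v \<in> K"
    unfolding mem_complexification_iff P_eq_0_iff[symmetric]
    by (simp add: vec_eq_0_re_im)
  show "heis_bracket u v \<in> K" if "u \<in> K" "v \<in> K"
    using that
    by (auto simp: mem_complexification_iff bracket_re_im intro!: subspace_add subspace_diff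
        subspace_h bracket_h)
  obtain d where d: "heis_bracket u v = d *s heis_Z" by (rule heis_bracket_in_Z)
  have "P heis_Z = 0 \<or> P heis_Z = heis_Z"
    using P_eq_0_iff P_Z by blast
  then have "complexify P heis_Z = 0 \<or> complexify P heis_Z = heis_Z"
    by (auto intro: re_im_eqI simp: linear_0[OF linear_P])
  then show "heis_bracket (complexify P (heis_bracket u v)) w = 0"
    unfolding d complexify_scale[OF linear_P] by (auto simp: heis_bracket_linear)
qed

text \<open>
  The imaginary parts of those points of the complex group at which every imaginary central
  translation can be undone by \<open>G\<close> on the left and \<open>K\<close> on the right.
\<close>

definition \<Omega> :: "(real, 'n) heis set" where
  "\<Omega> = {y. heis_Z \<in> h \<or> (\<exists>u\<in>h. heis_bracket y u \<noteq> 0)}"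

definition hZ :: "(real, 'n) heis set" where
  "hZ = {u + t *\<^sub>R heis_Z | u t. u \<in> h}"

lemma hZI: "u \<in> h \<Longrightarrow> u + t *\<^sub>R heis_Z \<in> hZ"
  unfolding hZ_def by blast

lemma subspace_hZ: "subspace hZ"
proof -
  have "hZ = {x + y | x y. x \<in> h \<and> y \<in> span {heis_Z}}"
    unfolding hZ_def span_singleton by blast
  then show ?thesis
    using subspace_sums[OF subspace_h subspace_span] by simp
qed

lemma h_subset_hZ: "u \<in> h \<Longrightarrow> u \<in> hZ"
  using hZI[of u 0] by simp

lemma bracket_in_hZ: "heis_bracket u v \<in> hZ"
proof -
  obtain c where "heis_bracket u v = c *s heis_Z" by (rule heis_bracket_in_Z)
  then show ?thesis
    using hZI[of 0 c] subspace_0[OF subspace_h] by (simp add: scaleR_eq_smult_real)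
qed

lemma \<Omega>_add: 
  assumes "y \<in> \<Omega>" "x \<in> hZ"
  shows "y + x \<in> \<Omega>"
proof -
  obtain u t where x: "x = u + t *\<^sub>R heis_Z" "u \<in> h" using assms unfolding hZ_def by blast
  have "heis_bracket (y + x) v = heis_bracket y v" if "heis_Z \<notin> h" "v \<in> h" for v
    using that x bracket_h_zero[of u v] by (simp add: heis_bracket_linear scaleR_eq_smult_real)
  then show ?thesis using assms(1) unfolding \<Omega>_def by force
qed

lemma open_\<Omega>: "open \<Omega>"
proof -
  have "open {y. heis_bracket y u \<noteq> 0}" for u :: "(real, 'n) heis"
    by (intro open_Collect_neq continuous_intros
        bounded_bilinear.continuous_on[OF bounded_bilinear_heis_bracket_real])
  then have "open (\<Union>u\<in>h. {y. heis_bracket y u \<noteq> 0})" by blast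
  moreover have "\<Omega> = (if heis_Z \<in> h then UNIV else (\<Union>u\<in>h. {y. heis_bracket y u \<noteq> 0}))"
    by (auto simp: \<Omega>_def)
  ultimately show ?thesis by simp
qed

text \<open>
  A complement of \<open>hZ\<close> on which the involution \<open>\<theta>\<close> defined below is \<open>-1\<close>.
\<close>

definition transversal :: "(real, 'n) heis set" where
  "transversal = {x. P x = x \<and> \<zeta> x = 0}"

lemma subspace_transversal: "subspace transversal"
  unfolding transversal_def
  by (rule subspaceI)
    (auto simp: linear_0 linear_add linear_cmul linear_P linear_zeta)

lemma transversal_decomp:
  obtains x where "x \<in> transversal" "y - x \<in> hZ"
proof -
  have *: "y - P y \<in> h"
    using P_eq_0_iff[of "y - P y"] by (simp add: linear_diff[OF linear_P] P_P)
  show thesis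
  proof (cases "heis_Z \<in> h")
    case True
    then show thesis
      using that[of "P y"] * by (simp add: transversal_def P_P zeta_P h_subset_hZ)
  next
    case False
    let ?x = "P y - \<zeta> (P y) *\<^sub>R heis_Z"
    have "?x \<in> transversal"
      by (simp add: transversal_def linear_diff[OF linear_P] linear_cmul[OF linear_P] P_P P_Z[OF False]
          linear_diff[OF linear_zeta] linear_cmul[OF linear_zeta])
    moreover have "y - ?x \<in> hZ"
      using hZI[OF *, of "\<zeta> (P y)"] by (simp add: algebra_simps)
    ultimately show thesis by (rule that)
  qed
qed

text \<open>
  If \<open>Z \<notin> h\<close>, a nonzero \<open>u \<in> h\<close> is not a multiple of \<open>Z\<close>, hence does not commute with some \<open>y\<close>. As
  \<open>\<Omega>\<close> is invariant under \<open>hZ\<close>, the point \<open>y\<close> can be moved into the complement.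
\<close>

lemma transversal_meets_\<Omega>:
  assumes "h \<noteq> {0}"
  obtains x where "x \<in> transversal" "x \<in> \<Omega>"
proof -
  have "\<exists>y. y \<in> \<Omega>"
  proof (cases "heis_Z \<in> h")
    case False
    from assms obtain u where u: "u \<in> h" "u \<noteq> 0"
      using subspace_0[OF subspace_h] by blast
    have "\<exists>y. heis_bracket y u \<noteq> 0"
    proof (rule ccontr)
      assume "\<nexists>y. heis_bracket y u \<noteq> 0"
      then have 0: "heis_bracket (heis_X i) u = 0" "heis_bracket (heis_Y i) u = 0" for i
        by auto
      have "heis_bracket (heis_X i) u = u $ Inr (Inl i) *s heis_Z"
        "heis_bracket (heis_Y i) u = (- (u $ Inl i)) *s heis_Z" for i
        by (simp_all add: heis_bracket_def heis_X_def heis_Y_def axis_def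
            mult_delta_left sum_subtractf sum_negf)
      with 0 have "u $ Inr (Inl i) = 0" "u $ Inl i = 0" for i
        by (simp_all add: vec.scale_eq_0_iff)
      note u_XY = this
      define c where "c = u $ Inr (Inr ())"
      have "u $ j = (c *\<^sub>R heis_Z) $ j" for j
      proof (cases j)
        case (Inr j')
        then show ?thesis by (cases j') (simp_all add: u_XY c_def heis_Z_def axis_def)
      qed (simp add: u_XY heis_Z_def axis_def)
      then have "u = c *\<^sub>R heis_Z" by (simp only: vec_eq_iff simp_thms)
      moreover from this have "c \<noteq> 0" using u(2) by auto
      ultimately have "heis_Z = (1 / c) *\<^sub>R u" by simp
      with False u(1) subspace_scale[OF subspace_h, of u "1 / c"] show False by simp
    qed
    then show ?thesis using u(1) unfolding \<Omega>_def by blast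
  qed (auto simp: \<Omega>_def)
  then obtain y where y: "y \<in> \<Omega>" ..
  obtain x where x: "x \<in> transversal" "y - x \<in> hZ" by (rule transversal_decomp)
  have "y + - (y - x) \<in> \<Omega>"
    using y x(2) by (intro \<Omega>_add subspace_neg subspace_hZ)
  then show thesis using that x(1) by simp
qed

lemma im_vec_mult:
  "im_vec (u \<otimes>\<^bsub>heis_group\<^esub> v) - (im_vec u + im_vec v) \<in> hZ"
proof -
  have "im_vec (u \<otimes>\<^bsub>heis_group\<^esub> v) - (im_vec u + im_vec v) =
      (1/2) *\<^sub>R (heis_bracket (re_vec u) (im_vec v) + heis_bracket (im_vec u) (re_vec v))"
    by (simp add: mult_heis_group bracket_re_im)
  then show ?thesis
    by (simp add: subspace_scale subspace_add subspace_hZ bracket_in_hZ)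
qed

text \<open>
  The class of the imaginary part modulo \<open>hZ\<close> is an invariant of the double coset.
\<close>

lemma im_vec_mult_real_K:
  assumes "k \<in> K"
  shows "im_vec (cvec l \<otimes>\<^bsub>heis_group\<^esub> w \<otimes>\<^bsub>heis_group\<^esub> k) - im_vec w \<in> hZ"
proof -
  let ?lw = "cvec l \<otimes>\<^bsub>heis_group\<^esub> w"
  have "im_vec k \<in> hZ"
    using assms by (simp add: mem_complexification_iff h_subset_hZ)
  then have "(im_vec (?lw \<otimes>\<^bsub>heis_group\<^esub> k) - (im_vec ?lw + im_vec k)) +
      (im_vec ?lw - (im_vec (cvec l) + im_vec w)) + im_vec k \<in> hZ"
    by (intro subspace_add subspace_hZ im_vec_mult)
  then show ?thesis by simp
qed

text \<open>
  The key step. If \<open>Z \<notin> h\<close>, choose \<open>u \<in> h\<close> with \<open>[Im w, u] \<noteq> 0\<close> and a real \<open>a\<close> with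
  \<open>a [Im w, u] = s Z\<close>. Conjugation by \<open>w\<close> gives
  \<open>w \<otimes> (a u) \<otimes> w\<inverse> = a u + a [Re w, u] + \<i> s Z\<close>, and the first two terms are real, so they can be moved
  to the left factor.
\<close>

lemma imaginary_Z_absorbed:
  assumes "im_vec w \<in> \<Omega>"
  obtains r k where "k \<in> K"
    "(\<i> *s cvec (s *\<^sub>R heis_Z)) \<otimes>\<^bsub>heis_group\<^esub> w = cvec r \<otimes>\<^bsub>heis_group\<^esub> w \<otimes>\<^bsub>heis_group\<^esub> k"
proof (cases "heis_Z \<in> h")
  case True
  then have "\<i> *s cvec (s *\<^sub>R heis_Z) \<in> K"
    by (simp add: mem_complexification_iff subspace_0 subspace_scale subspace_h)
  moreover have "(\<i> *s cvec (s *\<^sub>R heis_Z)) \<otimes>\<^bsub>heis_group\<^esub> w =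
      cvec 0 \<otimes>\<^bsub>heis_group\<^esub> w \<otimes>\<^bsub>heis_group\<^esub> (\<i> *s cvec (s *\<^sub>R heis_Z))"
    by (simp add: mult_heis_group cvec_scaleR heis_bracket_linear)
  ultimately show thesis by (rule that)
next
  case False
  then obtain u where u: "u \<in> h" "heis_bracket (im_vec w) u \<noteq> 0"
    using assms unfolding \<Omega>_def by blast
  obtain c where c: "heis_bracket (im_vec w) u = c *s heis_Z" by (rule heis_bracket_in_Z)
  with u have "c \<noteq> 0" by auto
  define a where "a = s / c"
  have a: "a *\<^sub>R heis_bracket (im_vec w) u = s *\<^sub>R heis_Z"
    using \<open>c \<noteq> 0\<close> by (simp add: a_def c scaleR_eq_smult_real)
  define r where "r = - a *\<^sub>R u - a *\<^sub>R heis_bracket (re_vec w) u"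
  define k where "k = cvec (a *\<^sub>R u)"
  have bwk: "heis_bracket w k = complex_of_real a *s cvec (heis_bracket (re_vec w) u) + \<i> *s cvec (s *\<^sub>R heis_Z)"
    unfolding a[symmetric]
    by (rule re_im_eqI)
      (simp_all add: k_def bracket_re_im heis_bracket_linear scaleR_eq_smult_real)
  have r: "cvec r = - k - complex_of_real a *s cvec (heis_bracket (re_vec w) u)"
    by (simp add: r_def k_def cvec_diff cvec_minus cvec_scaleR)
  have brw: "heis_bracket (cvec r) w = heis_bracket w k"
    unfolding r heis_bracket_cvec[symmetric]
    by (simp add: heis_bracket_diff heis_bracket_linear heis_bracket_antisym[of k w])
  have brk: "heis_bracket (cvec r) k = 0"
    unfolding r heis_bracket_cvec[symmetric]
    by (simp add: heis_bracket_diff heis_bracket_linear)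
  have "cvec r \<otimes>\<^bsub>heis_group\<^esub> w \<otimes>\<^bsub>heis_group\<^esub> k = cvec r + w + k + heis_bracket w k"
  proof -
    have half: "(1/2) *s v + (1/2) *s v = v" for v :: "(complex, 'n) heis"
      by (simp flip: vec.scale_left_distrib)
    have "cvec r \<otimes>\<^bsub>heis_group\<^esub> w \<otimes>\<^bsub>heis_group\<^esub> k =
        cvec r + w + (1/2) *s heis_bracket w k + k + (1/2) *s heis_bracket w k"
      by (simp add: mult_heis_group heis_bracket_linear brw brk)
    also have "\<dots> = cvec r + w + k + ((1/2) *s heis_bracket w k + (1/2) *s heis_bracket w k)"
      by (simp only: ac_simps)
    finally show ?thesis unfolding half .
  qed
  also have "\<dots> = w + \<i> *s cvec (s *\<^sub>R heis_Z)"
    by (simp add: r bwk)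
  also have "\<dots> = (\<i> *s cvec (s *\<^sub>R heis_Z)) \<otimes>\<^bsub>heis_group\<^esub> w"
    by (simp add: mult_heis_group cvec_scaleR heis_bracket_linear)
  finally have "(\<i> *s cvec (s *\<^sub>R heis_Z)) \<otimes>\<^bsub>heis_group\<^esub> w =
    cvec r \<otimes>\<^bsub>heis_group\<^esub> w \<otimes>\<^bsub>heis_group\<^esub> k" by simp
  moreover have "k \<in> K"
    using u(1) by (simp add: k_def mem_complexification_iff subspace_0 subspace_scale subspace_h)
  ultimately show thesis using that by blast
qed

text \<open>
  One inclusion is the invariance of the imaginary part. For the other, a correction by an element
  of \<open>K\<close> makes the imaginary parts agree up to the centre, a left translation by \<open>G\<close> makes the real
  parts agree, and the remaining imaginary central element is absorbed.
\<close>

lemma orbit_left_translation: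
  assumes w: "im_vec w \<in> \<Omega>"
  shows "orbit heis_group (left_translation K) (w <#\<^bsub>heis_group\<^esub> K) =
    {w' <#\<^bsub>heis_group\<^esub> K | w'. im_vec w' - im_vec w \<in> hZ}"
proof (intro subset_antisym subsetI)
  fix x assume "x \<in> orbit heis_group (left_translation K) (w <#\<^bsub>heis_group\<^esub> K)"
  then obtain l where x: "x = (cvec l \<otimes>\<^bsub>heis_group\<^esub> w) <#\<^bsub>heis_group\<^esub> K"
    unfolding orbit_def left_translation_coset by blast
  have "0 \<in> K" using subgroup.one_closed[OF subgroup_K] by simp
  then have "im_vec (cvec l \<otimes>\<^bsub>heis_group\<^esub> w) - im_vec w \<in> hZ"
    using im_vec_mult_real_K[of 0 l w] by (simp add: mult_heis_group)
  with x show "x \<in> {w' <#\<^bsub>heis_group\<^esub> K | w'. im_vec w' - im_vec w \<in> hZ}" by blast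
next
  fix x assume "x \<in> {w' <#\<^bsub>heis_group\<^esub> K | w'. im_vec w' - im_vec w \<in> hZ}"
  then obtain w' where x: "x = w' <#\<^bsub>heis_group\<^esub> K" and w': "im_vec w' - im_vec w \<in> hZ" by blast
  from w' obtain u t where ut: "im_vec w' - im_vec w = u + t *\<^sub>R heis_Z" "u \<in> h"
    unfolding hZ_def by blast
  define k where "k = \<i> *s cvec u"
  have k: "k \<in> K"
    using ut(2) by (simp add: k_def mem_complexification_iff subspace_0 subspace_h)
  define wk where "wk = w \<otimes>\<^bsub>heis_group\<^esub> k"
  define m where "m = w' \<otimes>\<^bsub>heis_group\<^esub> (- wk)"
  \<comment> \<open>After the correction by \<open>k\<close> the imaginary parts differ by a central element only.\<close>
  have "\<exists>s. im_vec m = s *\<^sub>R heis_Z"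
  proof -
    have Z: "\<exists>c. heis_bracket x y = c *\<^sub>R heis_Z" for x y :: "(real, 'n) heis"
      using heis_bracket_in_Z[of x y] by (metis scaleR_eq_smult_real)
    have "im_vec wk = im_vec w + u + (1/2) *\<^sub>R heis_bracket (re_vec w) u"
      by (simp add: wk_def k_def mult_heis_group bracket_re_im)
    then have "im_vec m = t *\<^sub>R heis_Z - (1/2) *\<^sub>R heis_bracket (re_vec w) u
        - (1/2) *\<^sub>R (heis_bracket (re_vec w') (im_vec wk) + heis_bracket (im_vec w') (re_vec wk))"
      using ut(1) by (simp add: m_def mult_heis_group bracket_re_im algebra_simps)
    also have "\<exists>s. \<dots> = s *\<^sub>R heis_Z"
      using Z[of "re_vec w" u] Z[of "re_vec w'" "im_vec wk"] Z[of "im_vec w'" "re_vec wk"]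
      by (elim exE) (simp only: scaleR_scaleR flip: scaleR_diff_left scaleR_add_left, blast)
    finally show ?thesis .
  qed
  then obtain s where s: "im_vec m = s *\<^sub>R heis_Z" ..
  have m: "m = cvec (re_vec m) \<otimes>\<^bsub>heis_group\<^esub> (\<i> *s cvec (s *\<^sub>R heis_Z))"
    by (rule re_im_eqI) (simp_all add: mult_heis_group cvec_scaleR heis_bracket_linear s)
  obtain r k' where k': "k' \<in> K" and r: "(\<i> *s cvec (s *\<^sub>R heis_Z)) \<otimes>\<^bsub>heis_group\<^esub> w =
      cvec r \<otimes>\<^bsub>heis_group\<^esub> w \<otimes>\<^bsub>heis_group\<^esub> k'"
    by (rule imaginary_Z_absorbed[OF w])
  let ?l = "re_vec m \<otimes>\<^bsub>heis_group\<^esub> r"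
  have "w' = m \<otimes>\<^bsub>heis_group\<^esub> wk"
    using heis.m_assoc[of w' "- wk" wk] heis.l_inv[of wk] heis.r_one[of w'] by (simp add: m_def)
  also have "\<dots> = cvec (re_vec m) \<otimes>\<^bsub>heis_group\<^esub>
      ((\<i> *s cvec (s *\<^sub>R heis_Z)) \<otimes>\<^bsub>heis_group\<^esub> w) \<otimes>\<^bsub>heis_group\<^esub> k"
    by (subst m) (simp add: wk_def heis.m_assoc)
  also have "\<dots> = cvec ?l \<otimes>\<^bsub>heis_group\<^esub> w \<otimes>\<^bsub>heis_group\<^esub> (k' \<otimes>\<^bsub>heis_group\<^esub> k)"
    unfolding r mult_cvec[symmetric] by (simp add: heis.m_assoc)
  finally have "w' \<in> (cvec ?l \<otimes>\<^bsub>heis_group\<^esub> w) <#\<^bsub>heis_group\<^esub> K"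
    using subgroup.m_closed[OF subgroup_K k' k] unfolding l_coset_def by blast
  then have "x = left_translation K ?l (w <#\<^bsub>heis_group\<^esub> K)"
    unfolding x left_translation_coset using lcoset_heis_eq_iff[OF subgroup_K] by blast
  then show "x \<in> orbit heis_group (left_translation K) (w <#\<^bsub>heis_group\<^esub> K)"
    unfolding orbit_def by auto
qed

text \<open>
  The reflection that is \<open>1\<close> on the centre and \<open>-1\<close> on the kernel of \<open>\<zeta>\<close>.
\<close>

definition \<theta> :: "(real, 'n) heis \<Rightarrow> (real, 'n) heis" where
  "\<theta> x = (2 * \<zeta> x) *\<^sub>R heis_Z - x"

lemma linear_\<theta>: "linear \<theta>"
  unfolding \<theta>_def
  by (rule linearI)
    (simp_all add: linear_add[OF linear_zeta] linear_cmul[OF linear_zeta] algebra_simps)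

lemma \<theta>_\<theta> [simp]: "\<theta> (\<theta> x) = x"
  by (simp add: \<theta>_def linear_diff[OF linear_zeta] linear_cmul[OF linear_zeta])

text \<open>
  Modulo the centre \<open>\<theta>\<close> is \<open>-1\<close>, which does not change a bracket, and brackets are central, hence
  fixed by \<open>\<theta>\<close>.
\<close>

lemma \<theta>_bracket: "\<theta> (heis_bracket x y) = heis_bracket (\<theta> x) (\<theta> y)"
proof -
  obtain c where c: "heis_bracket x y = c *\<^sub>R heis_Z"
    using heis_bracket_in_Z[of x y] by (metis scaleR_eq_smult_real)
  have "\<theta> (c *\<^sub>R heis_Z) = c *\<^sub>R heis_Z"
    by (simp add: \<theta>_def linear_cmul[OF linear_zeta] flip: scaleR_diff_left)
  moreover have "heis_bracket (\<theta> x) (\<theta> y) = heis_bracket x y"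
    by (simp add: \<theta>_def heis_bracket_linear heis_bracket_diff scaleR_eq_smult_real)
  ultimately show ?thesis by (simp add: c)
qed

text \<open>
  Either \<open>h\<close> contains the centre, or \<open>\<theta>\<close> is \<open>-1\<close> on \<open>h\<close>.
\<close>

lemma \<theta>_h: "x \<in> h \<Longrightarrow> \<theta> x \<in> h"
  by (cases "heis_Z \<in> h")
    (auto simp: \<theta>_def zeta_h intro!: subspace_diff subspace_neg subspace_scale subspace_h)

text \<open>
  The conjugate-linear extension of \<open>\<theta>\<close>.
\<close>

definition conj_\<theta> :: "(complex, 'n) heis \<Rightarrow> (complex, 'n) heis" where
  "conj_\<theta> w = cvec (\<theta> (re_vec w)) - \<i> *s cvec (\<theta> (im_vec w))"

lemma re_im_conj_\<theta> [simp]: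
  "re_vec (conj_\<theta> w) = \<theta> (re_vec w)" "im_vec (conj_\<theta> w) = - \<theta> (im_vec w)"
  by (simp_all add: conj_\<theta>_def)

lemma conj_\<theta>_conj_\<theta> [simp]: "conj_\<theta> (conj_\<theta> w) = w"
  by (rule re_im_eqI) (simp_all add: linear_neg[OF linear_\<theta>])

lemma conj_\<theta>_add: "conj_\<theta> (u + v) = conj_\<theta> u + conj_\<theta> v"
  by (rule re_im_eqI) (simp_all add: linear_add[OF linear_\<theta>])

lemma conj_\<theta>_scale: "conj_\<theta> (c *s v) = cnj c *s conj_\<theta> v"
  by (rule re_im_eqI)
    (simp_all add: linear_add[OF linear_\<theta>] linear_diff[OF linear_\<theta>] linear_cmul[OF linear_\<theta>])

lemma conj_\<theta>_mult:
  "conj_\<theta> (u \<otimes>\<^bsub>heis_group\<^esub> v) = conj_\<theta> u \<otimes>\<^bsub>heis_group\<^esub> conj_\<theta> v"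
proof -
  have "conj_\<theta> (heis_bracket u v) = heis_bracket (conj_\<theta> u) (conj_\<theta> v)"
    by (rule re_im_eqI)
      (simp_all add: bracket_re_im \<theta>_bracket linear_add[OF linear_\<theta>] linear_diff[OF linear_\<theta>])
  then show ?thesis
    by (simp add: mult_heis_group conj_\<theta>_add conj_\<theta>_scale)
qed

lemma conj_\<theta>_K: "conj_\<theta> ` K = K"
proof -
  have "conj_\<theta> k \<in> K" if "k \<in> K" for k
    using that by (simp add: mem_complexification_iff \<theta>_h subspace_neg subspace_h)
  then show ?thesis
    by (metis conj_\<theta>_conj_\<theta> image_subset_iff subset_antisym subsetI image_eqI)
qed

lemma bounded_linear_conj_\<theta>: "bounded_linear conj_\<theta>"
  unfolding linear_conv_bounded_linear[symmetric]
  by (rule linearI) (simp_all add: conj_\<theta>_add conj_\<theta>_scale scaleR_eq_smult)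

definition \<sigma> :: "(complex, 'n) heis set \<Rightarrow> (complex, 'n) heis set" where
  "\<sigma> C = conj_\<theta> ` C"

lemma \<sigma>_coset: "\<sigma> (g <#\<^bsub>heis_group\<^esub> K) = conj_\<theta> g <#\<^bsub>heis_group\<^esub> K"
proof -
  have "\<sigma> (g <#\<^bsub>heis_group\<^esub> K) = (\<Union>k\<in>K. {conj_\<theta> g \<otimes>\<^bsub>heis_group\<^esub> conj_\<theta> k})"
    unfolding \<sigma>_def l_coset_def by (simp add: image_UN conj_\<theta>_mult)
  also have "\<dots> = (\<Union>k\<in>conj_\<theta> ` K. {conj_\<theta> g \<otimes>\<^bsub>heis_group\<^esub> k})" by blast
  finally show ?thesis unfolding conj_\<theta>_K l_coset_def .
qed

text \<open>
  Both \<open>\<sigma>\<close> and its inverse have the lift \<open>conj_\<theta>\<close>.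
\<close>

lemma antiholomorphic_diffeo_\<sigma>: "antiholomorphic_diffeo (coset_topology K) (coset_atlas K) \<sigma>"
proof -
  let ?X = "lcosets\<^bsub>heis_group\<^esub> K"
  have \<sigma>\<sigma>: "\<sigma> (\<sigma> C) = C" for C
    by (simp add: \<sigma>_def image_image)
  have closed: "\<sigma> C \<in> ?X" if "C \<in> ?X" for C
    using that by (auto simp: lcosets_heis \<sigma>_coset)
  have bij: "bij_betw \<sigma> ?X ?X"
    by (rule bij_betw_byWitness[where f' = \<sigma>]) (auto simp: \<sigma>\<sigma> closed)
  have inv: "inv_into ?X \<sigma> (g <#\<^bsub>heis_group\<^esub> K) = conj_\<theta> g <#\<^bsub>heis_group\<^esub> K" for g
    using inv_into_f_eq[OF bij_betw_imp_inj_on[OF bij], of "conj_\<theta> g <#\<^bsub>heis_group\<^esub> K"]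
    by (simp add: \<sigma>_coset)
  have cont: "continuous_on UNIV conj_\<theta>"
    by (rule linear_continuous_on[OF bounded_linear_conj_\<theta>])
  have holo: "twisted_holomorphic_on cnj conj_\<theta> UNIV"
    unfolding twisted_holomorphic_on_def
    using bounded_linear_imp_has_derivative[OF bounded_linear_conj_\<theta>] conj_\<theta>_scale by blast
  show ?thesis
    unfolding antiholomorphic_diffeo_def topspace_coset_topology
    using bij antiholomorphic_map_coset_lift[OF cont holo, of \<sigma> K, OF \<sigma>_coset]
      antiholomorphic_map_coset_lift[OF cont holo, of "inv_into ?X \<sigma>" K, OF inv]
    by blast
qed

text \<open>
  With \<open>R = \<i> \<cdot> transversal\<close>, the slice \<open>S\<close> is the part of \<open>R\<close> over \<open>\<Omega>\<close>, and \<open>D\<close>, the image of all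
  points over \<open>\<Omega>\<close>, is the union of the orbits through \<open>S\<close>.
\<close>

lemma strongly_visible_left_translation:
  assumes "h \<noteq> {0}"
  shows "strongly_visible heis_group euclidean (left_translation K) (coset_topology K) (coset_atlas K)"
proof -
  let ?p = "\<lambda>g. g <#\<^bsub>heis_group\<^esub> K"
  let ?orb = "orbit heis_group (left_translation K)"
  define R where "R = (\<lambda>y. \<i> *s cvec y) ` transversal"
  define S where "S = ?p ` (R \<inter> {w. im_vec w \<in> \<Omega>})"
  define D where "D = ?p ` {w. im_vec w \<in> \<Omega>}"
  have S: "x \<in> S \<longleftrightarrow> (\<exists>y. y \<in> transversal \<and> y \<in> \<Omega> \<and> x = ?p (\<i> *s cvec y))" for x
    unfolding S_def R_def by auto
  have linear_i: "linear (\<lambda>y :: (real, 'n) heis. \<i> *s cvec y)"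
    by (rule linearI) (simp_all add: cvec_add cvec_scaleR scaleR_eq_smult vec.scale_right_distrib mult.commute)
  have sub: "real_submanifold (coset_topology K) (coset_atlas K) S"
    unfolding S_def
  proof (rule real_submanifold_slice)
    show "subspace R"
      unfolding R_def by (rule linear_subspace_image[OF linear_i subspace_transversal])
    have "complexify P (\<i> *s cvec y) = \<i> *s cvec y" if "y \<in> transversal" for y
      using that by (intro re_im_eqI) (auto simp: transversal_def linear_0[OF linear_P])
    then show "R \<subseteq> range (complexify P)"
      unfolding R_def by (metis image_subsetI rangeI)
    show "open {w. im_vec w \<in> \<Omega>}"
      using open_vimage[OF open_\<Omega> continuous_on_im_vec] by (simp add: vimage_def)
  qed
  have orb_D: "?orb x \<subseteq> D" if "x \<in> D" for x
  proof -
    from that obtain w where w: "x = ?p w" "im_vec w \<in> \<Omega>" unfolding D_def by blast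
    have "im_vec w' \<in> \<Omega>" if "im_vec w' - im_vec w \<in> hZ" for w'
      using \<Omega>_add[OF w(2) that] by simp
    then show ?thesis
      unfolding w(1) orbit_left_translation[OF w(2)] D_def by blast
  qed
  have D: "(\<Union>x\<in>S. ?orb x) = D"
  proof (intro subset_antisym)
    have "S \<subseteq> D" unfolding S_def D_def by blast
    then show "(\<Union>x\<in>S. ?orb x) \<subseteq> D" using orb_D by blast
    show "D \<subseteq> (\<Union>x\<in>S. ?orb x)"
    proof
      fix x assume "x \<in> D"
      then obtain w where w: "x = ?p w" "im_vec w \<in> \<Omega>" unfolding D_def by blast
      obtain y where y: "y \<in> transversal" "im_vec w - y \<in> hZ" by (rule transversal_decomp)
      \<comment> \<open>The orbit of \<open>x\<close> meets \<open>S\<close> in the coset of \<open>\<i> y\<close>.\<close>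
      have "im_vec w + - (im_vec w - y) \<in> \<Omega>"
        using w(2) y(2) by (intro \<Omega>_add subspace_neg subspace_hZ)
      then have "y \<in> \<Omega>" by simp
      then have "?p (\<i> *s cvec y) \<in> S" using y(1) S by blast
      moreover have "x \<in> ?orb (?p (\<i> *s cvec y))"
        using \<open>y \<in> \<Omega>\<close> w(1) y(2) by (subst orbit_left_translation) auto
      ultimately show "x \<in> (\<Union>x\<in>S. ?orb x)" by blast
    qed
  qed
  obtain y where "y \<in> transversal" "y \<in> \<Omega>" by (rule transversal_meets_\<Omega>[OF assms])
  then have "D \<noteq> {}"
    unfolding D_def by (auto intro!: exI[of _ "\<i> *s cvec y"])
  moreover have "openin (coset_topology K) D"
  proof -
    have "im_vec g \<in> \<Omega>" if "?p g \<in> D" for g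
    proof -
      from that obtain w where w: "?p g = ?p w" "im_vec w \<in> \<Omega>" unfolding D_def by blast
      then have "g \<in> ?p w" using lcoset_heis_eq_iff[OF subgroup_K, of w g] by simp
      then obtain k where k: "k \<in> K" "g = w \<otimes>\<^bsub>heis_group\<^esub> k" unfolding l_coset_def by blast
      have "im_vec g - im_vec w \<in> hZ"
        using im_vec_mult_real_K[OF k(1), of 0 w] by (simp add: zero_mult_heis k(2))
      then show ?thesis using \<Omega>_add[OF w(2)] by fastforce
    qed
    then have "{g. ?p g \<in> D} = {g. im_vec g \<in> \<Omega>}" unfolding D_def by blast
    moreover have "open {g :: (complex, 'n) heis. im_vec g \<in> \<Omega>}"
      using open_vimage[OF open_\<Omega> continuous_on_im_vec] by (simp add: vimage_def)
    ultimately show ?thesis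
      unfolding openin_coset_topology by (auto simp: D_def)
  qed
  moreover have "\<sigma> x = x" if "x \<in> S" for x
  proof -
    from that obtain y where y: "y \<in> transversal" "x = ?p (\<i> *s cvec y)" using S by blast
    have "\<theta> y = - y" using y(1) by (simp add: transversal_def \<theta>_def)
    then have "conj_\<theta> (\<i> *s cvec y) = \<i> *s cvec y"
      by (intro re_im_eqI) (simp_all add: linear_0[OF linear_\<theta>])
    then show ?thesis by (simp add: y(2) \<sigma>_coset)
  qed
  moreover have "\<sigma> ` ?orb x = ?orb x" if "x \<in> D" for x
  proof -
    from that obtain w where w: "x = ?p w" "im_vec w \<in> \<Omega>" unfolding D_def by blast
    \<comment> \<open>As \<open>\<sigma>\<close> is an involution, one inclusion suffices.\<close>
    have sub: "\<sigma> C \<in> ?orb x" if "C \<in> ?orb x" for C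
    proof -
      from that obtain w' where w': "C = ?p w'" "im_vec w' - im_vec w \<in> hZ"
        unfolding w(1) orbit_left_translation[OF w(2)] by blast
      have "- (2 * \<zeta> (im_vec w')) *\<^sub>R heis_Z \<in> hZ"
        using hZI[OF subspace_0[OF subspace_h], of "- (2 * \<zeta> (im_vec w'))"] by simp
      from subspace_add[OF subspace_hZ w'(2) this]
      have "im_vec (conj_\<theta> w') - im_vec w \<in> hZ"
        by (simp add: \<theta>_def algebra_simps)
      then show ?thesis
        unfolding w(1) w'(1) orbit_left_translation[OF w(2)] \<sigma>_coset by blast
    qed
    have "C \<in> \<sigma> ` ?orb x" if "C \<in> ?orb x" for C
      using sub[OF that] by (rule rev_image_eqI) (simp add: \<sigma>_def image_image)
    with sub show ?thesis by blast
  qed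
  ultimately show ?thesis
    unfolding strongly_visible_def Let_def
    using complex_manifold_coset connected_space_coset holomorphic_action_left_translation
      sub antiholomorphic_diffeo_\<sigma> D by metis
qed

end

section \<open>The Lie algebra of a connected closed subgroup\<close>

text \<open>
  Group commutators in exponential coordinates are brackets, exactly and not only to second order.
  Hence brackets of elements of the Lie algebra lie in it, and they correct the product
  \<open>(t u) \<otimes> (t v)\<close> to \<open>t (u + v)\<close>.
\<close>

lemma subspace_lie_algebra_of:
  fixes H :: "(real, 'n::finite) heis set"
  assumes H: "subgroup H heis_group"
  shows "subspace (lie_algebra_of H)"
    and "u \<in> lie_algebra_of H \<Longrightarrow> v \<in> lie_algebra_of H \<Longrightarrow> heis_bracket u v \<in> lie_algebra_of H"
proof -
  have mem: "v \<in> lie_algebra_of H \<longleftrightarrow> (\<forall>t. t *\<^sub>R v \<in> H)" for v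
    by (simp add: lie_algebra_of_def heis_exp_def scaleR_eq_smult_real)
  have mult: "x \<otimes>\<^bsub>heis_group\<^esub> y \<in> H" if "x \<in> H" "y \<in> H" for x y
    using subgroup.m_closed[OF H that] .
  have bracket: "heis_bracket u v \<in> lie_algebra_of H"
    if "u \<in> lie_algebra_of H" "v \<in> lie_algebra_of H" for u v
    unfolding mem
  proof
    fix t
    have "(t *\<^sub>R u) \<otimes>\<^bsub>heis_group\<^esub> (1 *\<^sub>R v) \<otimes>\<^bsub>heis_group\<^esub> ((- t) *\<^sub>R u) \<otimes>\<^bsub>heis_group\<^esub> ((- 1) *\<^sub>R v) \<in> H"
      using that by (intro mult) (simp_all only: mem)
    also have "(t *\<^sub>R u) \<otimes>\<^bsub>heis_group\<^esub> (1 *\<^sub>R v) \<otimes>\<^bsub>heis_group\<^esub> ((- t) *\<^sub>R u) \<otimes>\<^bsub>heis_group\<^esub> ((- 1) *\<^sub>R v)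
        = t *\<^sub>R heis_bracket u v"
      by (simp add: mult_heis_group scaleR_eq_smult_real heis_bracket_linear
          heis_bracket_antisym[of v u] algebra_simps flip: vec.scale_left_distrib)
    finally show "t *\<^sub>R heis_bracket u v \<in> H" .
  qed
  then show "u \<in> lie_algebra_of H \<Longrightarrow> v \<in> lie_algebra_of H \<Longrightarrow> heis_bracket u v \<in> lie_algebra_of H" .
  show "subspace (lie_algebra_of H)"
  proof (rule subspaceI)
    show "0 \<in> lie_algebra_of H"
      using subgroup.one_closed[OF H] by (simp add: mem)
    show "c *\<^sub>R x \<in> lie_algebra_of H" if "x \<in> lie_algebra_of H" for c x
      using that by (simp add: mem)
    show "u + v \<in> lie_algebra_of H" if uv: "u \<in> lie_algebra_of H" "v \<in> lie_algebra_of H" for u v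
      unfolding mem
    proof
      fix t
      have "(t *\<^sub>R u) \<otimes>\<^bsub>heis_group\<^esub> (t *\<^sub>R v) \<otimes>\<^bsub>heis_group\<^esub> ((- (t * t / 2)) *\<^sub>R heis_bracket u v) \<in> H"
        using uv bracket[OF uv] by (intro mult) (simp_all only: mem)
      also have "(t *\<^sub>R u) \<otimes>\<^bsub>heis_group\<^esub> (t *\<^sub>R v) \<otimes>\<^bsub>heis_group\<^esub> ((- (t * t / 2)) *\<^sub>R heis_bracket u v)
          = t *\<^sub>R (u + v)"
        by (simp add: mult_heis_group scaleR_eq_smult_real heis_bracket_linear vec.scale_right_distrib)
      finally show "t *\<^sub>R (u + v) \<in> H" .
    qed
  qed
qed

lemma subgroup_scaleR_int:
  fixes H :: "(real, 'n::finite) heis set"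
  assumes H: "subgroup H heis_group" and x: "x \<in> H"
  shows "of_int m *\<^sub>R x \<in> H"
proof -
  have nat: "of_nat k *\<^sub>R x \<in> H" for k
  proof (induction k)
    case 0
    then show ?case using subgroup.one_closed[OF H] by simp
  next
    case (Suc k)
    have "(of_nat k *\<^sub>R x) \<otimes>\<^bsub>heis_group\<^esub> x = of_nat (Suc k) *\<^sub>R x"
      by (simp add: mult_heis_group scaleR_eq_smult_real heis_bracket_linear
          vec.scale_left_distrib)
    with subgroup.m_closed[OF H Suc x] show ?case by simp
  qed
  show ?thesis
  proof (cases m rule: int_cases2)
    case (nonpos k)
    then show ?thesis using subgroup.m_inv_closed[OF H nat[of k]] by simp
  qed (use nat in simp)
qed

text \<open>
  A connected set with more than one point has no isolated points, so there are \<open>f n \<rightarrow> 0\<close> in \<open>H - {0}\<close>,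
  and along a subsequence their directions converge to a unit vector \<open>v\<close>. In exponential
  coordinates powers are multiples, and the integer multiples of \<open>f n\<close> divide the line
  through \<open>f n\<close> into steps whose length tends to zero; as \<open>H\<close> is closed, it contains the line through \<open>v\<close>.
\<close>

lemma lie_algebra_of_nontrivial:
  fixes H :: "(real, 'n::finite) heis set"
  assumes "connected_closed_subgroup H" and "H \<noteq> {0}"
  shows "lie_algebra_of H \<noteq> {0}"
proof -
  from assms have H: "subgroup H heis_group" "closed H" "connected H"
    by (auto simp: connected_closed_subgroup_def)
  have 0: "0 \<in> H" using subgroup.one_closed[OF H(1)] by simp
  have "0 islimpt H"
    using connected_imp_perfect[OF H(3) 0] assms(2) 0 by auto
  then obtain f where f: "\<And>n. f n \<in> H - {0}" "f \<longlonglongrightarrow> 0"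
    unfolding islimpt_sequential by blast
  have "\<forall>n. sgn (f n) \<in> sphere 0 1"
    using f(1) by (simp add: norm_sgn)
  then obtain v r where v: "v \<in> sphere 0 1" and r: "strict_mono (r :: nat \<Rightarrow> nat)"
    and lim: "((\<lambda>n. sgn (f n)) \<circ> r) \<longlonglongrightarrow> v"
    using seq_compactE[OF compact_imp_seq_compact[OF compact_sphere[of "0 :: (real, 'n) heis" 1]],
        of "\<lambda>n. sgn (f n)"] by metis
  have "t *\<^sub>R v \<in> H" for t
  proof -
    define a where "a n = norm (f (r n))" for n
    \<comment> \<open>The multiple of the length of \<open>f (r n)\<close> next to \<open>t\<close> from below.\<close>
    define b where "b n = of_int \<lfloor>t / a n\<rfloor> * a n" for n
    have apos: "a n > 0" for n using f(1) by (simp add: a_def)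
    have a0: "a \<longlonglongrightarrow> 0"
      unfolding a_def
      using LIMSEQ_subseq_LIMSEQ[OF tendsto_norm_zero[OF f(2)] r] by (simp add: comp_def)
    have "norm (b n - t) \<le> a n" for n
    proof -
      have "b n \<le> t" "t < b n + a n"
        using floor_divide_lower[OF apos[of n], of t] floor_divide_upper[OF apos[of n], of t]
        by (simp_all add: b_def distrib_right)
      then show ?thesis by simp
    qed
    then have "(\<lambda>n. b n - t) \<longlonglongrightarrow> 0"
      by (intro Lim_null_comparison[OF _ a0]) simp
    then have "b \<longlonglongrightarrow> t" by (simp add: LIM_zero_iff)
    then have limit: "(\<lambda>n. b n *\<^sub>R sgn (f (r n))) \<longlonglongrightarrow> t *\<^sub>R v"
      using lim by (intro tendsto_scaleR) (simp_all add: comp_def)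
    have "b n *\<^sub>R sgn (f (r n)) \<in> H" for n
    proof -
      have "b n *\<^sub>R sgn (f (r n)) = of_int \<lfloor>t / a n\<rfloor> *\<^sub>R f (r n)"
        using apos[of n] by (simp add: b_def sgn_div_norm a_def)
      moreover have "f (r n) \<in> H" using f(1) by blast
      ultimately show ?thesis by (simp only: subgroup_scaleR_int[OF H(1)])
    qed
    then show ?thesis
      by (rule closed_sequentially[OF H(2) _ limit])
  qed
  then have "v \<in> lie_algebra_of H"
    by (simp add: lie_algebra_of_def heis_exp_def flip: scaleR_eq_smult_real)
  moreover have "v \<noteq> 0" using v by auto
  ultimately show ?thesis by blast
qed

theorem theorem1p1:
  fixes H :: "(real, 'n::finite) heis set"
  assumes "connected_closed_subgroup H"
    and "H \<noteq> {\<one>\<^bsub>heis_group\<^esub>}"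
    and "H \<noteq> carrier heis_group"
  shows "\<exists>L. connected_closed_subgroup L \<and>
    strongly_visible (heis_group\<lparr>carrier := L\<rparr>) (top_of_set L)
      (left_translation (complex_subgroup H))
      (coset_topology (complex_subgroup H)) (coset_atlas (complex_subgroup H))"
proof -
  define h where "h = lie_algebra_of H"
  have H: "subgroup H heis_group"
    using assms(1) by (simp add: connected_closed_subgroup_def)
  have h: "subspace h" "\<And>u v. u \<in> h \<Longrightarrow> v \<in> h \<Longrightarrow> heis_bracket u v \<in> h"
    unfolding h_def using subspace_lie_algebra_of[OF H] by blast+
  obtain P and \<zeta> :: "(real, 'n) heis \<Rightarrow> real" where P: "linear P" "linear \<zeta>"
    "\<forall>x. P (P x) = P x" "\<forall>x. P x = 0 \<longleftrightarrow> x \<in> h" "\<zeta> heis_Z = 1"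
    "heis_Z \<in> h \<longrightarrow> (\<forall>x. \<zeta> (P x) = 0)" "heis_Z \<notin> h \<longrightarrow> P heis_Z = heis_Z \<and> (\<forall>x\<in>h. \<zeta> x = 0)"
    by (rule exists_adapted_projection[OF h(1) heis_Z_nonzero])
  interpret adapted_subalgebra h P \<zeta>
    using P(6,7) by (intro adapted_subalgebra.intro h P(1,2,5) P(3,4)[rule_format]) blast+
  have K: "complex_subgroup H = complexification h"
    by (simp add: complex_subgroup_def h_def heis_exp_def)
  have "h \<noteq> {0}"
    unfolding h_def using lie_algebra_of_nontrivial[OF assms(1)] assms(2) by simp
  then have "strongly_visible heis_group euclidean (left_translation K) (coset_topology K) (coset_atlas K)"
    by (rule strongly_visible_left_translation)
  moreover have "(heis_group :: (real, 'n) heis monoid) = heis_group\<lparr>carrier := UNIV\<rparr>"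
    by (simp add: heis_group_def)
  ultimately have "strongly_visible (heis_group\<lparr>carrier := UNIV\<rparr>) (top_of_set UNIV)
      (left_translation K) (coset_topology K) (coset_atlas K)"
    by (simp only: subtopology_UNIV)
  moreover have "connected_closed_subgroup (UNIV :: (real, 'n) heis set)"
    using heis.subgroup_self by (simp add: connected_closed_subgroup_def connected_UNIV)
  ultimately show ?thesis
    unfolding K by blast
qed

end
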